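(* Consider the finite-dimensional setting $\mathcal{V}=\mathcal{H}_{\mathcal{V}}=\mathbb{R}^{n_u}$, $\mathcal{Q}=\mathcal{H}_{\mathcal{Q}}=\mathbb{R}^{n_p}$, such that $\mathcal{A},\mathcal{B},\widetilde{\mathcal{B}},\mathcal{C},\widehat{\mathcal{C}},\widetilde{\mathcal{C}},\mathcal{D},\widetilde{\mathcal{D}}$ are matrices (with the properties and constants listed in the context). Let the solution $(u,p,\theta)$ of \[ \mathcal{A}u-\mathcal{D}^*p-\widetilde{\mathcal{D}}^*\theta=f,\qquad \mathcal{D}\dot u+\mathcal{C}\dot p-\widehat{\mathcal{C}}\dot\theta+\mathcal{B}p=g,\qquad \widetilde{\mathcal{D}}\dot u+\widetilde{\mathcal{C}}\dot\theta-\widehat{\mathcal{C}}\dot p+\widetilde{\mathcal{B}}\theta=h \] on $[0,T]$ with $p(0)=p^0$, $\theta(0)=\theta^0$ satisfy $u\in C^2([0,T],\mathbb{R}^{n_u})$, $p\in C^2([0,T],\mathbb{R}^{n_p})$, and $\theta\in C^2([0,T],\mathbb{R}^{n_\theta})$, where $n_\theta=n_p$. Moreover, assume that the right-hand sides satisfy $f\in C^2([0,T],\mathbb{R}^{n_u})$, $g\in C^1([0,T],\mathbb{R}^{n_p})$, and $h\in C^1([0,T],\mathbb{R}^{n_\theta})$. For the initial data, assume the consistency conditions \[ \mathcal{B}p^0=g(0)-\mathcal{D}\mathcal{A}^{-1}\dot f(0)+\mathcal{O}(\tau),\qquad \widetilde{\mathcal{B}}\theta^0=h(0)-\widetilde{\mathcal{D}}\mathcal{A}^{-1}\dot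 f(0)+\mathcal{O}(\tau). \] Let \[ \omega_{\mathrm{HD}}:=\frac{C_d^2+C_{\widetilde d}^2}{c_a\,\min\{c_0-\widehat c_0,\ \widetilde c_0-\widehat c_0\}} . \] Then the approximations $(u^n,p^n,\theta^n)$ given by the iterative scheme described in the context with step size $\tau$ and $K$ inner iterations, where $K$ satisfies \[ \frac{\omega_{\mathrm{HD}}^K}{(2+\omega_{\mathrm{HD}})^{K-1}}<1, \] are first-order convergent, i.e., \[ \|u^n-u(t^n)\|_{\mathcal{A}}^2+\|p^n-p(t^n)\|_{\mathcal{B}}^2+\|\theta^n-\theta(t^n)\|_{\widetilde{\mathcal{B}}}^2\le C\,\tau^2 . \] The constant $C>0$ only depends on the solution, the right-hand sides, the time horizon, and the material parameters.
   Context: Finite-dimensional setting, i.e. after a spatial discretization of linear thermo--poroelasticity (displacement $u$, pressure $p$, temperature $\theta$). The matrices satisfy: - $\mathcal{A}$ is symmetric and elliptic with constant $c_a$ (with respect to the norm of $\mathcal{V}$); - $\mathcal{B},\widetilde{\mathcal{B}}$ are symmetric and elliptic; - $\mathcal{C},\widehat{\mathcal{C}},\widetilde{\mathcal{C}}$ are the inner product matrix of $\mathcal{H}_{\mathcal{Q}}$ scaled by the positive constants $c_0$, $\widehat c_0$, $\widetilde c_0$, respectively, where $\widehat c_0<\widetilde c_0$ and $\widehat c_0<c_0$; - $\mathcal{D},\widetilde{\mathcal{D}}$ are continuous as maps from $\mathcal{V}$ to $\mathcal{H}_{\mathcal{Q}}^*$ with constants $C_d$ and $C_{\widetilde d}$;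 $\mathcal{D}^*,\widetilde{\mathcal{D}}^*$ are their transposes. For a symmetric positive definite matrix $M$, $\|x\|_M^2:=x^\top Mx$. Further $t^n=n\tau$, and superscripts on $f,g,h$ denote evaluation in time, e.g. $f^{n+1}=f(t^{n+1})$. Scheme: define the relaxation parameter $\gamma:=\frac{2}{2+\omega_{\mathrm{HD}}}$ and let $K\in\mathbb{N}$ be the fixed number of inner iteration steps. In each time step, initialize $(u^{n+1,0},p^{n+1,0},\theta^{n+1,0}):=(u^n,p^n,\theta^n)$. For $k=0,\dots,K-1$, solve \[ \mathcal{A}u^{n+1,k+1}=\mathcal{D}^*p^{n+1,k}+\widetilde{\mathcal{D}}^*\theta^{n+1,k}+f^{n+1}, \] \[ \mathcal{D}u^{n+1,k+1}+(\mathcal{C}+\tau\mathcal{B})\hat p^{n+1,k+1}-\widehat{\mathcal{C}}\hat\theta^{n+1,k+1}=\mathcal{D}u^n+\mathcal{C}p^n-\widehat{\mathcal{C}}\theta^n+\tau g^{n+1}, \] \[ \widetilde{\mathcal{D}}u^{n+1,k+1}-\widehat{\mathcal{C}}\hat p^{n+1,k+1}+(\widetilde{\mathcal{C}}+\tau\widetilde{\mathcal{B}})\hat\theta^{n+1,k+1}=\widetilde{\mathcal{D}}u^n-\widehat{\mathcal{C}}p^n+\widetilde{\mathcal{C}}\theta^n+\tau h^{n+1} \] for $u^{n+1,k+1},\hat p^{n+1,k+1},\hat\theta^{n+1,k+1}$ and, except for the last step, dampen by setting \[ p^{n+1,k+1}:=\gamma\,\hat p^{n+1,k+1}+(1-\gamma)\,p^{n},\qquad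 \theta^{n+1,k+1}:=\gamma\,\hat\theta^{n+1,k+1}+(1-\gamma)\,\theta^{n}. \] Finally, set $u^{n+1}:=u^{n+1,K}$, $p^{n+1}:=\hat p^{n+1,K}$, $\theta^{n+1}:=\hat\theta^{n+1,K}$.
   Formalization: The damping step uses (1-γ)p^{n+1,k} and (1-γ)θ^{n+1,k} (the preceding inner iterate) instead of (1-γ)p^n and (1-γ)θ^n; with the printed formula the claim fails, e.g. for ω_HD = 2.8, K = 3. For K ≤ 2 both schemes coincide. *)

theory Defs
  imports "HOL-Analysis.Analysis"
begin

definition sym_pos_def :: "real^'n^'n \<Rightarrow> bool" where
  "sym_pos_def M \<longleftrightarrow> transpose M = M \<and> (\<forall>x. x \<noteq> 0 \<longrightarrow> 0 < x \<bullet> (M *v x))"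

definition wnorm :: "real^'n^'n \<Rightarrow> real^'n \<Rightarrow> real" where
  "wnorm M x = sqrt (x \<bullet> (M *v x))"

definition elliptic :: "real^'n^'n \<Rightarrow> real^'n^'n \<Rightarrow> real \<Rightarrow> bool" where
  "elliptic N M c \<longleftrightarrow> 0 < c \<and> (\<forall>x. c * (wnorm N x)\<^sup>2 \<le> x \<bullet> (M *v x))"

text \<open>Continuity of a matrix as a map from (R^m, NV) into the dual of (R^n, NH), where the
  dual is identified with R^n through the Euclidean pairing.\<close>

definition continuous_to_dual ::
  "real^'m^'m \<Rightarrow> real^'n^'n \<Rightarrow> real^'m^'n \<Rightarrow> real \<Rightarrow> bool" where
  "continuous_to_dual NV NH D c \<longleftrightarrow>
     (\<forall>v q. \<bar>q \<bullet> (D *v v)\<bar> \<le> c * wnorm NV v * wnorm NH q)"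

text \<open>Derivatives are taken within the set, hence one-sided at the end points of an interval.\<close>

fun Ck_on :: "nat \<Rightarrow> real set \<Rightarrow> (real \<Rightarrow> 'a::real_normed_vector) \<Rightarrow> bool" where
  "Ck_on 0 S f \<longleftrightarrow> continuous_on S f"
| "Ck_on (Suc k) S f \<longleftrightarrow>
     (\<exists>f'. (\<forall>t\<in>S. (f has_vector_derivative f' t) (at t within S)) \<and> Ck_on k S f')"

definition thermo_poro_solution ::
  "real^'u^'u \<Rightarrow> real^'p^'p \<Rightarrow> real^'p^'p \<Rightarrow> real^'p^'p \<Rightarrow> real^'p^'p \<Rightarrow> real^'p^'p \<Rightarrow>
   real^'u^'p \<Rightarrow> real^'u^'p \<Rightarrow>
   (real \<Rightarrow> real^'u) \<Rightarrow> (real \<Rightarrow> real^'p) \<Rightarrow> (real \<Rightarrow> real^'p) \<Rightarrow> real \<Rightarrow>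
   (real \<Rightarrow> real^'u) \<Rightarrow> (real \<Rightarrow> real^'p) \<Rightarrow> (real \<Rightarrow> real^'p) \<Rightarrow> bool" where
  "thermo_poro_solution A B Bt C Ch Ct D Dt f g h T u p \<theta> \<longleftrightarrow>
     (\<forall>t\<in>{0..T}.
        let du = vector_derivative u (at t within {0..T});
            dp = vector_derivative p (at t within {0..T});
            d\<theta> = vector_derivative \<theta> (at t within {0..T})
        in A *v u t - transpose D *v p t - transpose Dt *v \<theta> t = f t
         \<and> D *v du + C *v dp - Ch *v d\<theta> + B *v p t = g t
         \<and> Dt *v du + Ct *v d\<theta> - Ch *v dp + Bt *v \<theta> t = h t)"

definition omega_HD :: "real \<Rightarrow> real \<Rightarrow> real \<Rightarrow> real \<Rightarrow> real \<Rightarrow> real \<Rightarrow> real" where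
  "omega_HD c\<^sub>a c\<^sub>0 ch\<^sub>0 ct\<^sub>0 C\<^sub>d Ct\<^sub>d =
     (C\<^sub>d\<^sup>2 + Ct\<^sub>d\<^sup>2) / (c\<^sub>a * min (c\<^sub>0 - ch\<^sub>0) (ct\<^sub>0 - ch\<^sub>0))"

text \<open>Here \<open>uk n k\<close>, \<open>pk n k\<close>, \<open>\<theta>k n k\<close> stand for the \<open>k\<close>-th inner iterates of the
  time step from \<open>n\<close> to \<open>n + 1\<close>, and \<open>ph\<close>, \<open>\<theta>h\<close> for the undamped pressures and temperatures.
  The damping combines the new undamped value with the preceding inner iterate. Averaging with
  the value of the preceding time step instead would agree with this for at most two inner steps,
  but from three inner steps on it makes the scheme exponentially unstable for some parameters
  with \<open>\<omega> ^ K / (2 + \<omega>) ^ (K - 1) < 1\<close>, e.g. \<open>\<omega> = 2.8\<close>, \<open>K = 3\<close>.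
  The scheme is started from the displacement that is consistent with the initial pressure and
  temperature. Only the time steps inside \<open>[0, T]\<close> are constrained.\<close>

definition iterative_scheme ::
  "real^'u^'u \<Rightarrow> real^'p^'p \<Rightarrow> real^'p^'p \<Rightarrow> real^'p^'p \<Rightarrow> real^'p^'p \<Rightarrow> real^'p^'p \<Rightarrow>
   real^'u^'p \<Rightarrow> real^'u^'p \<Rightarrow>
   (real \<Rightarrow> real^'u) \<Rightarrow> (real \<Rightarrow> real^'p) \<Rightarrow> (real \<Rightarrow> real^'p) \<Rightarrow> real \<Rightarrow>
   real^'p \<Rightarrow> real^'p \<Rightarrow> real \<Rightarrow> real \<Rightarrow> nat \<Rightarrow>
   (nat \<Rightarrow> real^'u) \<Rightarrow> (nat \<Rightarrow> real^'p) \<Rightarrow> (nat \<Rightarrow> real^'p) \<Rightarrow> bool" where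
  "iterative_scheme A B Bt C Ch Ct D Dt f g h T p\<^sub>0 \<theta>\<^sub>0 \<omega> \<tau> K u p \<theta> \<longleftrightarrow>
     p 0 = p\<^sub>0 \<and> \<theta> 0 = \<theta>\<^sub>0 \<and>
     A *v u 0 = transpose D *v p\<^sub>0 + transpose Dt *v \<theta>\<^sub>0 + f 0 \<and>
     (\<exists>uk pk \<theta>k ph \<theta>h. \<forall>n. real (Suc n) * \<tau> \<le> T \<longrightarrow>
        (let \<gamma> = 2 / (2 + \<omega>); t = real (Suc n) * \<tau> in
          uk n 0 = u n \<and> pk n 0 = p n \<and> \<theta>k n 0 = \<theta> n \<and>
          (\<forall>k<K.
             A *v uk n (Suc k) = transpose D *v pk n k + transpose Dt *v \<theta>k n k + f t \<and>
             D *v uk n (Suc k) + (C + \<tau> *\<^sub>R B) *v ph n (Suc k) - Ch *v \<theta>h n (Suc k)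
               = D *v u n + C *v p n - Ch *v \<theta> n + \<tau> *\<^sub>R g t \<and>
             Dt *v uk n (Suc k) - Ch *v ph n (Suc k) + (Ct + \<tau> *\<^sub>R Bt) *v \<theta>h n (Suc k)
               = Dt *v u n - Ch *v p n + Ct *v \<theta> n + \<tau> *\<^sub>R h t) \<and>
          (\<forall>k. Suc k < K \<longrightarrow>
             pk n (Suc k) = \<gamma> *\<^sub>R ph n (Suc k) + (1 - \<gamma>) *\<^sub>R pk n k \<and>
             \<theta>k n (Suc k) = \<gamma> *\<^sub>R \<theta>h n (Suc k) + (1 - \<gamma>) *\<^sub>R \<theta>k n k) \<and>
          u (Suc n) = uk n K \<and> p (Suc n) = ph n K \<and> \<theta> (Suc n) = \<theta>h n K))"

end

theory Submission
  imports Defs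
begin

text \<open>Pressure and temperature are combined into one vector \<open>x\<close>, and the displacement is eliminated.
  With the block operator \<open>D\<close>, put \<open>S = D A\<^sup>-\<^sup>1 D\<^sup>T\<close>, let \<open>Cc\<close> and \<open>Bb\<close> be the block mass and
  stiffness matrices, and \<open>M = Cc + \<tau> Bb\<close>; then \<open>0 \<le> S \<le> \<omega> Cc \<le> \<omega> M\<close>.

  The increments \<open>w\<^sub>k\<close> from an inner iterate to the next undamped one satisfy
  \<open>M w\<^sub>k\<^sub>+\<^sub>1 = (1 - \<gamma>) M w\<^sub>k - \<gamma> S w\<^sub>k\<close>. The choice of \<open>\<gamma>\<close> is the one that makes the spectrum of this
  map symmetric about zero, and it contracts with factor \<open>\<omega> / (2 + \<omega>)\<close> in the norm of \<open>M\<close>. Since the first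
  increment of a time step contains \<open>- M\<^sup>-\<^sup>1 S z\<close>, where \<open>z\<close> is the last increment of the preceding time
  step, \<open>z\<close> obeys a recursion with factor \<open>\<rho> = \<omega>\<^sup>K / (2 + \<omega>)\<^sup>K\<^sup>-\<^sup>1 < 1\<close>.

  The scheme is the implicit Euler method up to \<open>z\<close>: for the error \<open>e\<close>, the quantity
  \<open>v = (S + M) e - S z\<close> changes by \<open>- \<tau> Bb e\<close> plus a defect of order \<open>\<tau>\<^sup>2\<close>. With \<open>a = \<parallel>v\<parallel>\<close> and
  \<open>b = \<parallel>z\<parallel>\<^sub>M\<close> this leads to a coupled recursion, for which \<open>a + \<kappa> \<tau> b\<close> with \<open>\<kappa> = c / (1 - \<rho>)\<close> is a
  discrete Gronwall functional without any restriction on the step size.\<close>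

section \<open>Scalar recursions of Gronwall type\<close>

lemma affine_recursion_bound:
  fixes E :: "nat \<Rightarrow> real"
  assumes "E 0 = 0" and "0 < \<alpha>" and "0 \<le> \<beta>"
    and step: "\<And>n. n < N \<Longrightarrow> E (Suc n) \<le> (1 + \<alpha>) * E n + \<beta>"
    and "n \<le> N"
  shows "E n \<le> \<beta> / \<alpha> * exp (\<alpha> * real n)"
proof -
  \<comment> \<open>The induction runs on the geometric sum, which the recursion reproduces exactly;
    the exponential enters only afterwards through
    \<open>1 + \<alpha> \<le> exp \<alpha>\<close>.\<close>
  have "E n \<le> \<beta> / \<alpha> * ((1 + \<alpha>) ^ n - 1)"
    using \<open>n \<le> N\<close>
  proof (induction n)
    case 0
    then show ?case using assms by simp
  next
    case (Suc n)
    have "E (Suc n) \<le> (1 + \<alpha>) * E n + \<beta>"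
      using step Suc.prems by simp
    also have "\<dots> \<le> (1 + \<alpha>) * (\<beta> / \<alpha> * ((1 + \<alpha>) ^ n - 1)) + \<beta>"
      using Suc assms by (intro add_right_mono mult_left_mono) auto
    also have "\<dots> = \<beta> / \<alpha> * ((1 + \<alpha>) ^ Suc n - 1)"
      using \<open>0 < \<alpha>\<close> by (simp add: field_simps)
    finally show ?case .
  qed
  also have "\<dots> \<le> \<beta> / \<alpha> * exp (\<alpha> * real n)"
  proof (rule mult_left_mono)
    have "(1 + \<alpha>) ^ n \<le> exp \<alpha> ^ n"
      using \<open>0 < \<alpha>\<close> exp_ge_add_one_self[of \<alpha>] by (intro power_mono) auto
    then show "(1 + \<alpha>) ^ n - 1 \<le> exp (\<alpha> * real n)"
      by (simp add: exp_of_nat2_mult)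
    show "0 \<le> \<beta> / \<alpha>"
      using assms by simp
  qed
  finally show ?thesis .
qed

text \<open>The bound is the fixed point of \<open>b \<mapsto> \<rho> * b + \<beta>\<close>; this
  monotone map keeps a sequence that starts below its fixed point below it.\<close>

lemma contractive_recursion_bound:
  fixes b :: "nat \<Rightarrow> real"
  assumes "b 0 = 0" and "0 \<le> \<rho>" and "\<rho> < 1" and "0 \<le> \<beta>"
    and step: "\<And>n. n < N \<Longrightarrow> b (Suc n) \<le> \<rho> * b n + \<beta>"
    and "n \<le> N"
  shows "b n \<le> \<beta> / (1 - \<rho>)"
  using \<open>n \<le> N\<close>
proof (induction n)
  case 0
  then show ?case using assms by simp
next
  case (Suc n)
  have "b (Suc n) \<le> \<rho> * (\<beta> / (1 - \<rho>)) + \<beta>"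
    using step[of n] Suc mult_left_mono[of "b n" "\<beta> / (1 - \<rho>)" \<rho>] \<open>0 \<le> \<rho>\<close> by linarith
  also have "\<dots> = \<beta> / (1 - \<rho>)"
    using \<open>\<rho> < 1\<close> by (simp add: field_simps)
  finally show ?case .
qed

text \<open>The argument takes two passes. The weighted sum of \<open>a\<close> and \<open>b\<close>
  gives the right order for \<open>a\<close>, but because of the weight
  \<open>\<kappa> * \<tau>\<close> only boundedness of \<open>b\<close>. Inserted into the
  contraction for \<open>b\<close>, this makes the coupling term of order \<open>\<tau>\<close> and
  yields the missing power. \<open>C\<close> is fixed before \<open>\<tau>\<close> and
  \<open>N\<close>.\<close>

lemma coupled_recursion_bound:
  fixes c \<rho> T :: real
  assumes "0 < c" and "0 \<le> \<rho>" and "\<rho> < 1" and "0 < T"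
  obtains C where "0 \<le> C"
    and "\<And>\<tau> N a b n. \<lbrakk>0 < \<tau>; real N * \<tau> \<le> T; a 0 = 0; b 0 = 0;
      \<And>n. 0 \<le> a n; \<And>n. 0 \<le> b n;
      \<And>n. n < N \<Longrightarrow> a (Suc n) \<le> a n + c * \<tau> * (a n + b n) + c * \<tau>\<^sup>2;
      \<And>n. n < N \<Longrightarrow> b (Suc n) \<le> \<rho> * b n + c * \<tau> * (a n + b n) + c * \<tau>; n \<le> N\<rbrakk>
      \<Longrightarrow> a n \<le> C * \<tau> \<and> b n \<le> C * \<tau>"
proof -
  \<comment> \<open>\<open>\<kappa>\<close> solves \<open>c + \<kappa> * \<rho> = \<kappa>\<close>:
    what a step of \<open>a\<close> takes from \<open>b\<close> and what survives of the weighted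
    \<open>b\<close> add up to the weight again. \<open>c'\<close> dominates the two remaining
    growth rates, \<open>c + \<kappa> * c * T\<close> in front of \<open>a\<close> and
    \<open>c\<close> in front of \<open>b\<close>.\<close>
  define \<kappa> where "\<kappa> = c / (1 - \<rho>)"
  define c' where "c' = c + \<kappa> * c * T + c"
  define E\<^sub>0 where "E\<^sub>0 = c * (1 + \<kappa>) / c' * exp (c' * T)"
  define \<beta> where "\<beta> = c * (E\<^sub>0 * T + E\<^sub>0 / \<kappa>) + c"
  define C where "C = E\<^sub>0 + \<beta> / (1 - \<rho>)"
  have \<kappa>: "0 < \<kappa>" "c + \<kappa> * \<rho> = \<kappa>"
    using assms by (auto simp: \<kappa>_def field_simps)
  have c': "0 < c'" using assms \<kappa> by (simp add: c'_def add_pos_nonneg)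
  have E0: "0 \<le> E\<^sub>0" using assms \<kappa> c' by (simp add: E\<^sub>0_def)
  have \<beta>: "0 \<le> \<beta>" using assms \<kappa> E0 by (simp add: \<beta>_def)
  show thesis
  proof (rule that[of C])
    show "0 \<le> C" using E0 \<beta> assms by (simp add: C_def)
    fix \<tau> :: real and N n :: nat and a b :: "nat \<Rightarrow> real"
    assume \<tau>: "0 < \<tau>" and N: "real N * \<tau> \<le> T" and a0: "a 0 = 0" and b0: "b 0 = 0"
      and a: "\<And>n. 0 \<le> a n" and b: "\<And>n. 0 \<le> b n"
      and sa: "\<And>n. n < N \<Longrightarrow> a (Suc n) \<le> a n + c * \<tau> * (a n + b n) + c * \<tau>\<^sup>2"
      and sb: "\<And>n. n < N \<Longrightarrow> b (Suc n) \<le> \<rho> * b n + c * \<tau> * (a n + b n) + c * \<tau>"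
      and n: "n \<le> N"
    \<comment> \<open>With \<open>N = 0\<close> the step size is not tied to \<open>T\<close>, so
      this bound requires that a step exists.\<close>
    have \<tau>T: "\<tau> \<le> T" if "k < N" for k
    proof -
      have "1 * \<tau> \<le> real N * \<tau>" using that \<tau> by (intro mult_right_mono) auto
      with N show ?thesis by simp
    qed
    define E where "E n = a n + \<kappa> * \<tau> * b n" for n
    have stepE: "E (Suc k) \<le> (1 + c' * \<tau>) * E k + c * (1 + \<kappa>) * \<tau>\<^sup>2" if k: "k < N" for k
    proof -
      have "E (Suc k) \<le> (a k + c * \<tau> * (a k + b k) + c * \<tau>\<^sup>2)
          + \<kappa> * \<tau> * (\<rho> * b k + c * \<tau> * (a k + b k) + c * \<tau>)"
        unfolding E_def using sa[OF k] sb[OF k] \<kappa> \<tau> by (intro add_mono mult_left_mono) auto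
      also have "\<dots> = a k * (1 + c * \<tau> + \<kappa> * c * \<tau> * \<tau>) + \<tau> * b k * ((c + \<kappa> * \<rho>) + \<kappa> * c * \<tau>)
          + c * (1 + \<kappa>) * \<tau>\<^sup>2"
        by (simp add: algebra_simps power2_eq_square)
      also have "\<dots> = a k * (1 + (c + \<kappa> * c * \<tau>) * \<tau>) + \<kappa> * \<tau> * b k * (1 + c * \<tau>)
          + c * (1 + \<kappa>) * \<tau>\<^sup>2"
        unfolding \<kappa>(2) by (simp add: algebra_simps)
      also have "\<dots> \<le> a k * (1 + c' * \<tau>) + \<kappa> * \<tau> * b k * (1 + c' * \<tau>) + c * (1 + \<kappa>) * \<tau>\<^sup>2"
      proof (intro add_mono mult_left_mono order_refl)
        have "\<kappa> * c * \<tau> \<le> \<kappa> * c * T" using \<kappa> \<tau>T[OF k] assms by (intro mult_left_mono) auto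
        then show "(c + \<kappa> * c * \<tau>) * \<tau> \<le> c' * \<tau>"
          using \<tau> \<open>0 < c\<close> by (intro mult_right_mono) (auto simp: c'_def)
        show "c * \<tau> \<le> c' * \<tau>"
          using \<tau> \<kappa> assms by (intro mult_right_mono) (auto simp: c'_def)
      qed (use a b \<kappa> \<tau> assms in auto)
      finally show ?thesis by (simp add: E_def algebra_simps)
    qed
    have EB: "E k \<le> E\<^sub>0 * \<tau>" if k: "k \<le> N" for k
    proof -
      have "E k \<le> (c * (1 + \<kappa>) * \<tau>\<^sup>2) / (c' * \<tau>) * exp (c' * \<tau> * real k)"
        using \<tau> c' \<kappa> assms a0 b0 stepE k
        by (intro affine_recursion_bound[where N = N]) (auto simp: E_def)
      also have "\<dots> = c * (1 + \<kappa>) / c' * \<tau> * exp (c' * (real k * \<tau>))"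
        using \<tau> by (simp add: power2_eq_square mult_ac)
      also have "\<dots> \<le> c * (1 + \<kappa>) / c' * \<tau> * exp (c' * T)"
      proof -
        have "real k * \<tau> \<le> real N * \<tau>" using k \<tau> by (intro mult_right_mono) auto
        then have "c' * (real k * \<tau>) \<le> c' * T" using N c' by (intro mult_left_mono) auto
        then show ?thesis using c' \<kappa> \<tau> assms by (intro mult_left_mono) auto
      qed
      finally show ?thesis by (simp add: E\<^sub>0_def mult_ac)
    qed
    have aB: "a k \<le> E\<^sub>0 * \<tau>" if "k \<le> N" for k
      using EB[OF that] \<kappa> \<tau> b[of k] by (simp add: E_def add_increasing2 order_trans[of "a k" "E k"])
    have bB: "b k \<le> E\<^sub>0 / \<kappa>" if "k \<le> N" for k
    proof -
      have "\<tau> * (\<kappa> * b k) \<le> \<tau> * E\<^sub>0"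
        using EB[OF that] a[of k] by (simp add: E_def mult_ac)
      then show ?thesis using \<tau> \<kappa> by (simp add: field_simps)
    qed
    have "b (Suc k) \<le> \<rho> * b k + \<beta> * \<tau>" if k: "k < N" for k
    proof -
      have "a k \<le> E\<^sub>0 * T"
        using aB[of k] k \<tau>T[OF k] E0 mult_left_mono[of \<tau> T E\<^sub>0] by simp
      then have "a k + b k \<le> E\<^sub>0 * T + E\<^sub>0 / \<kappa>"
        using bB[of k] k by simp
      then have "c * \<tau> * (a k + b k) \<le> c * \<tau> * (E\<^sub>0 * T + E\<^sub>0 / \<kappa>)"
        using \<tau> assms by (intro mult_left_mono) auto
      then show ?thesis using sb[OF k] by (simp add: \<beta>_def algebra_simps)
    qed
    then have "b n \<le> \<beta> * \<tau> / (1 - \<rho>)"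
      using contractive_recursion_bound[where b = b and \<beta> = "\<beta> * \<tau>", OF b0 assms(2,3) _ _ n] \<beta> \<tau> by simp
    moreover have "0 \<le> \<beta> / (1 - \<rho>) * \<tau>" "0 \<le> E\<^sub>0 * \<tau>"
      using \<beta> \<tau> assms E0 by auto
    ultimately show "a n \<le> C * \<tau> \<and> b n \<le> C * \<tau>"
      using aB[OF n] by (simp add: C_def algebra_simps)
  qed
qed

section \<open>Estimates for quadratic forms\<close>

text \<open>Polarization expresses the bilinear form of the symmetric \<open>L\<close> by its
  quadratic form at \<open>x + y\<close> and \<open>x - y\<close>, and the parallelogram law for
  \<open>M\<close> turns the bounds there into an arithmetic mean. Replacing \<open>x\<close> by
  \<open>-x\<close> gives the other sign.\<close>

lemma form_Cauchy_Schwarz: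
  fixes L M :: "'x::real_inner \<Rightarrow> 'x"
  assumes "linear L" and "linear M" and "\<And>x y. x \<bullet> L y = L x \<bullet> y"
    and bound: "\<And>x. \<bar>x \<bullet> L x\<bar> \<le> q * (x \<bullet> M x)"
    and pos: "\<And>x. x \<noteq> 0 \<Longrightarrow> 0 < x \<bullet> M x"
  shows "\<bar>x \<bullet> L y\<bar> \<le> q * (sqrt (x \<bullet> M x) * sqrt (y \<bullet> M y))"
proof -
  interpret L: linear L by fact
  interpret M: linear M by fact
  have polar: "2 * (x \<bullet> L y) \<le> q * (x \<bullet> M x + y \<bullet> M y)" for x y
  proof -
    have "4 * (x \<bullet> L y) = (x + y) \<bullet> L (x + y) - (x - y) \<bullet> L (x - y)"
      using assms(3)[of y x]
      by (simp add: L.add L.diff inner_simps inner_commute)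
    also have "\<dots> \<le> q * ((x + y) \<bullet> M (x + y)) + q * ((x - y) \<bullet> M (x - y))"
      using bound[of "x + y"] bound[of "x - y"] by linarith
    also have "\<dots> = 2 * (q * (x \<bullet> M x + y \<bullet> M y))"
      by (simp add: M.add M.diff inner_simps algebra_simps)
    finally show ?thesis by simp
  qed
  have upper: "x \<bullet> L y \<le> q * (sqrt (x \<bullet> M x) * sqrt (y \<bullet> M y))" for x y
  proof (cases "x = 0 \<or> y = 0")
    case True
    then show ?thesis by (auto simp: L.zero)
  next
    case False
    define r s where "r = sqrt (x \<bullet> M x)" and "s = sqrt (y \<bullet> M y)"
    have rs: "0 < r" "0 < s" "x \<bullet> M x = r\<^sup>2" "y \<bullet> M y = s\<^sup>2"
      using False pos[of x] pos[of y] by (auto simp: r_def s_def)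
    \<comment> \<open>The factors \<open>s\<close> and \<open>r\<close> make the form of
      \<open>M\<close> equal to \<open>(r * s)\<^sup>2\<close> at both vectors, where the arithmetic
      mean is already the product.\<close>
    have "(r * s) * (2 * (x \<bullet> L y)) \<le> (r * s) * (2 * (q * (r * s)))"
      using polar[of "s *\<^sub>R x" "r *\<^sub>R y"] rs
      by (simp add: L.scaleR M.scaleR power2_eq_square algebra_simps)
    then have "2 * (x \<bullet> L y) \<le> 2 * (q * (r * s))"
      using rs by (simp add: mult_le_cancel_left_pos)
    then show ?thesis by (simp add: r_def s_def)
  qed
  have sq: "sqrt ((-x) \<bullet> M (-x)) = sqrt (x \<bullet> M x)"
    by (simp add: M.neg)
  show ?thesis
    using upper[of x y] upper[of "-x" y] unfolding sq by (simp add: abs_le_iff)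
qed

text \<open>The form attains its minimum on the compact unit sphere, where it is positive, and it is
  homogeneous of degree two.\<close>

lemma positive_definite_bounded_below:
  fixes M :: "'x::euclidean_space \<Rightarrow> 'x"
  assumes "linear M" and pos: "\<And>x. x \<noteq> 0 \<Longrightarrow> 0 < x \<bullet> M x"
  obtains \<mu> where "0 < \<mu>" and "\<And>x. \<mu> * (norm x)\<^sup>2 \<le> x \<bullet> M x"
proof -
  interpret M: linear M by fact
  have "continuous_on (sphere 0 1) (\<lambda>x. x \<bullet> M x)"
    using linear_continuous_on[OF linear_conv_bounded_linear[THEN iffD1, OF \<open>linear M\<close>]]
    by (intro continuous_intros)
  moreover have "sphere (0::'x) 1 \<noteq> {}"
    by (simp add: sphere_eq_empty)
  ultimately obtain y where y: "y \<in> sphere 0 1" "\<And>x. x \<in> sphere 0 1 \<Longrightarrow> y \<bullet> M y \<le> x \<bullet> M x"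
    using continuous_attains_inf[of "sphere (0::'x) 1"] by (metis compact_sphere)
  show thesis
  proof (rule that[of "y \<bullet> M y"])
    show "0 < y \<bullet> M y" using y(1) by (intro pos) auto
    show "(y \<bullet> M y) * (norm x)\<^sup>2 \<le> x \<bullet> M x" for x
    proof (cases "x = 0")
      case False
      have "y \<bullet> M y \<le> (x /\<^sub>R norm x) \<bullet> M (x /\<^sub>R norm x)"
        using False by (intro y) simp
      then show ?thesis
        using False by (simp add: M.scaleR power2_eq_square field_simps)
    qed simp
  qed
qed

lemma positive_definite_sqrt_bound:
  fixes M :: "'x::real_inner \<Rightarrow> 'x"
  assumes "0 < \<mu>" and "\<And>x. \<mu> * (norm x)\<^sup>2 \<le> x \<bullet> M x"
  shows "norm x \<le> sqrt (x \<bullet> M x) / sqrt \<mu>"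
proof -
  have "sqrt (\<mu> * (norm x)\<^sup>2) \<le> sqrt (x \<bullet> M x)"
    using assms(2) by (rule real_sqrt_le_mono)
  then show ?thesis
    using \<open>0 < \<mu>\<close> by (simp add: real_sqrt_mult field_simps)
qed

section \<open>Inner iteration and propagation of the error over the time steps\<close>

text \<open>Consecutive solves share the datum \<open>r\<close>, so \<open>M\<close> times the new
  increment is \<open>L = (1 - \<gamma>) M - \<gamma> S\<close> applied to the old one. Since
  \<open>0 \<le> S \<le> \<omega> M\<close> as forms, \<open>L\<close> lies between
  \<open>1 - \<gamma> - \<gamma> * \<omega>\<close> and \<open>1 - \<gamma>\<close> times
  \<open>M\<close>, and the choice of \<open>\<gamma>\<close> makes these factors \<open>- q\<close>
  and \<open>q\<close>.\<close>

lemma relaxed_iteration_contraction: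
  fixes M S :: "'x::real_inner \<Rightarrow> 'x" and xh x :: "nat \<Rightarrow> 'x"
  assumes lin: "linear M" "linear S"
    and sym: "\<And>x y. x \<bullet> M y = M x \<bullet> y" "\<And>x y. x \<bullet> S y = S x \<bullet> y"
    and pos: "\<And>x. x \<noteq> 0 \<Longrightarrow> 0 < x \<bullet> M x"
    and S0: "\<And>x. 0 \<le> x \<bullet> S x" and S1: "\<And>x. x \<bullet> S x \<le> \<omega> * (x \<bullet> M x)"
    and \<omega>: "0 \<le> \<omega>" and \<gamma>: "\<gamma> = 2 / (2 + \<omega>)"
    and solve: "\<And>k. k < K \<Longrightarrow> M (xh (Suc k)) = r - S (x k)"
    and damp: "\<And>k. Suc k < K \<Longrightarrow> x (Suc k) = \<gamma> *\<^sub>R xh (Suc k) + (1 - \<gamma>) *\<^sub>R x k"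
    and "k < K"
  defines "w \<equiv> \<lambda>k. xh (Suc k) - x k"
  shows "sqrt (w k \<bullet> M (w k)) \<le> (\<omega> / (2 + \<omega>)) ^ k * sqrt (w 0 \<bullet> M (w 0))"
  using \<open>k < K\<close>
proof (induction k)
  case 0
  then show ?case by simp
next
  case (Suc k)
  interpret M: linear M by fact
  interpret S: linear S by fact
  define q where "q = \<omega> / (2 + \<omega>)"
  define L where "L y = q *\<^sub>R M y - \<gamma> *\<^sub>R S y" for y
  have q: "0 \<le> q" "1 - \<gamma> = q" "\<gamma> * \<omega> = 2 * q" "0 \<le> \<gamma>"
    using \<omega> by (auto simp: q_def \<gamma> field_simps)
  have "M (w (Suc k)) = (r - S (x (Suc k))) - M (x (Suc k))"
    using solve[OF Suc.prems] by (simp add: w_def M.diff)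
  also have "\<dots> = L (w k)"
  proof -
    have x: "x (Suc k) = x k + \<gamma> *\<^sub>R w k"
      using damp[OF Suc.prems] by (simp add: w_def algebra_simps)
    have "M (w k) = r - S (x k) - M (x k)"
      using solve[of k] Suc.prems by (simp add: w_def M.diff)
    then have r: "r = M (w k) + S (x k) + M (x k)" by simp
    show ?thesis
      unfolding x r L_def q(2)[symmetric]
      by (simp add: M.add S.add M.scaleR S.scaleR algebra_simps)
  qed
  finally have MwL: "M (w (Suc k)) = L (w k)" .
  have "\<bar>y \<bullet> L y\<bar> \<le> q * (y \<bullet> M y)" for y
  proof -
    have "\<gamma> * (y \<bullet> S y) \<le> 2 * (q * (y \<bullet> M y))"
      using mult_left_mono[OF S1[of y] q(4)] by (simp add: mult.assoc[symmetric] q(3))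
    moreover have "0 \<le> \<gamma> * (y \<bullet> S y)" using q(4) S0 by simp
    ultimately show ?thesis
      by (simp add: L_def inner_simps abs_le_iff)
  qed
  moreover have "linear L"
    unfolding L_def
    by (intro linear_compose_sub linear_compose_scale_right lin)
  moreover have "y \<bullet> L y' = L y \<bullet> y'" for y y'
    by (simp add: L_def inner_simps sym)
  ultimately have "\<bar>w (Suc k) \<bullet> L (w k)\<bar>
      \<le> q * (sqrt (w (Suc k) \<bullet> M (w (Suc k))) * sqrt (w k \<bullet> M (w k)))"
    using form_Cauchy_Schwarz[OF _ lin(1) _ _ pos, where L = L] by blast
  \<comment> \<open>Tested with the new increment itself, the bilinear bound contains its norm on
    both sides; one factor is cancelled below, unless the increment vanishes.\<close>
  then have *: "w (Suc k) \<bullet> M (w (Suc k))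
      \<le> q * (sqrt (w (Suc k) \<bullet> M (w (Suc k))) * sqrt (w k \<bullet> M (w k)))"
    by (simp add: MwL)
  have "0 \<le> y \<bullet> M y" for y
    using pos[of y] by (cases "y = 0") (auto simp: less_imp_le)
  note nn = this
  have "sqrt (w (Suc k) \<bullet> M (w (Suc k))) \<le> q * sqrt (w k \<bullet> M (w k))"
  proof (cases "w (Suc k) = 0")
    case False
    define s where "s = sqrt (w (Suc k) \<bullet> M (w (Suc k)))"
    have "0 < s" "w (Suc k) \<bullet> M (w (Suc k)) = s * s"
      using pos[OF False] nn by (auto simp: s_def)
    then have "s * s \<le> s * (q * sqrt (w k \<bullet> M (w k)))"
      using * by (simp add: mult_ac)
    with \<open>0 < s\<close> show ?thesis by (simp add: s_def[symmetric])
  qed (use q nn in simp)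
  also have "\<dots> \<le> q * (q ^ k * sqrt (w 0 \<bullet> M (w 0)))"
    using Suc q by (intro mult_left_mono) (auto simp: q_def)
  finally show ?case by (simp add: q_def)
qed

text \<open>Here \<open>M = Cc + \<tau> Bb\<close> is the implicit matrix, \<open>e\<close> the error of pressure and temperature,
  \<open>z\<close> the increment of the last inner step (zero for the initial value), \<open>w\<close> the increment of the
  first one, \<open>d\<close> the increment of the exact solution over a time step, and \<open>R\<close> the consistency
  defect.\<close>

definition splitting_error_system ::
  "('x::real_inner \<Rightarrow> 'x) \<Rightarrow> ('x \<Rightarrow> 'x) \<Rightarrow> ('x \<Rightarrow> 'x) \<Rightarrow> real \<Rightarrow> real \<Rightarrow> real \<Rightarrow> nat \<Rightarrow>
   (nat \<Rightarrow> 'x) \<Rightarrow> (nat \<Rightarrow> 'x) \<Rightarrow> (nat \<Rightarrow> 'x) \<Rightarrow> (nat \<Rightarrow> 'x) \<Rightarrow> (nat \<Rightarrow> 'x) \<Rightarrow> bool" where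
  "splitting_error_system S Cc Bb \<Lambda> \<tau> q N e z w d R \<longleftrightarrow> e 0 = 0 \<and> z 0 = 0 \<and>
     (\<forall>n<N. norm (d n) \<le> \<Lambda> * \<tau> \<and> norm (R n) \<le> \<Lambda> * \<tau>\<^sup>2 \<and>
        S (e (Suc n)) + Cc (e (Suc n)) + \<tau> *\<^sub>R Bb (e (Suc n)) - S (z (Suc n))
          = S (e n) + Cc (e n) - S (z n) - R n \<and>
        Cc (w n) + \<tau> *\<^sub>R Bb (w n)
          = S (d n) + Cc (d n) + \<tau> *\<^sub>R Bb (d n) - R n - \<tau> *\<^sub>R Bb (e n) - S (z n) \<and>
        sqrt (z (Suc n) \<bullet> (Cc (z (Suc n)) + \<tau> *\<^sub>R Bb (z (Suc n))))
          \<le> q * sqrt (w n \<bullet> (Cc (w n) + \<tau> *\<^sub>R Bb (w n))))"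

text \<open>The recursion closes in the norm of \<open>v\<close> and the \<open>M\<close>-norm of
  \<open>z\<close>, because testing \<open>(S + M) e = v + S z\<close> with \<open>e\<close>
  recovers the error from these two. The constant is chosen before \<open>\<tau>\<close>,
  \<open>q\<close> and \<open>N\<close>, hence is uniform in the step size and the number of inner
  steps.\<close>

lemma splitting_error_bound:
  fixes S Cc Bb :: "'x::euclidean_space \<Rightarrow> 'x"
  assumes lin: "linear S" "linear Cc" "linear Bb"
    and sym: "\<And>x y. x \<bullet> S y = S x \<bullet> y" "\<And>x y. x \<bullet> Cc y = Cc x \<bullet> y" "\<And>x y. x \<bullet> Bb y = Bb x \<bullet> y"
    and S0: "\<And>x. 0 \<le> x \<bullet> S x" and S1: "\<And>x. x \<bullet> S x \<le> \<omega> * (x \<bullet> Cc x)"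
    and C0: "\<And>x. x \<noteq> 0 \<Longrightarrow> 0 < x \<bullet> Cc x" and B0: "\<And>x. 0 \<le> x \<bullet> Bb x"
    and \<omega>: "0 \<le> \<omega>" and \<rho>: "0 \<le> \<rho>" "\<rho> < 1" and T: "0 < T" and \<Lambda>: "0 \<le> \<Lambda>"
  obtains Cst where "0 \<le> Cst"
    and "\<And>\<tau> q N e z w d R n. \<lbrakk>0 < \<tau>; real N * \<tau> \<le> T; 0 \<le> q; q \<le> 1; q * \<omega> \<le> \<rho>;
      splitting_error_system S Cc Bb \<Lambda> \<tau> q N e z w d R; n \<le> N\<rbrakk>
      \<Longrightarrow> norm (e n) \<le> Cst * \<tau> \<and> norm (z n) \<le> Cst * \<tau>"
proof -
  interpret S: linear S by fact
  interpret Cc: linear Cc by fact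
  interpret Bb: linear Bb by fact
  \<comment> \<open>Coercivity is taken from \<open>Cc\<close> and not from the
    \<open>\<tau>\<close>-dependent \<open>M\<close>, so \<open>\<mu>\<close> is independent of the
    step size.\<close>
  obtain \<mu> where \<mu>: "0 < \<mu>" "\<And>x. \<mu> * (norm x)\<^sup>2 \<le> x \<bullet> Cc x"
    using positive_definite_bounded_below[OF lin(2) C0] by blast
  have bnd: "\<exists>K>0. \<forall>x. norm (F x) \<le> K * norm x" if "linear F" for F :: "'x \<Rightarrow> 'x"
    using linear_bounded_pos[OF that] by blast
  obtain s where s: "0 < s" "\<And>x. norm (S x) \<le> s * norm x" using bnd[OF lin(1)] by blast
  obtain c where c: "0 < c" "\<And>x. norm (Cc x) \<le> c * norm x" using bnd[OF lin(2)] by blast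
  obtain \<beta> where \<beta>: "0 < \<beta>" "\<And>x. norm (Bb x) \<le> \<beta> * norm x" using bnd[OF lin(3)] by blast
  \<comment> \<open>\<open>\<nu>\<close> is the constant in the bound of \<open>e\<close> by
    \<open>v\<close> and \<open>z\<close>. \<open>k\<close> dominates, in this order, the stiffness
    term and the defect in the recursion for \<open>v\<close>, then the parts of the recursion for
    \<open>z\<close> that are proportional to the errors and to \<open>\<tau>\<close> alone;
    dividing by \<open>sqrt \<mu>\<close> passes from the Euclidean norm to that of
    \<open>M\<close>.\<close>
  define \<nu> where "\<nu> = (1 + s / sqrt \<mu>) / \<mu>"
  define k where "k = \<beta> * \<nu> + \<Lambda> + \<beta> * \<nu> / sqrt \<mu> + ((s + c + T * \<beta>) * \<Lambda> + \<Lambda> * T) / sqrt \<mu>"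
  have \<nu>: "0 < \<nu>" using \<mu> s by (simp add: \<nu>_def add_pos_pos)
  have k: "0 < k" "\<beta> * \<nu> \<le> k" "\<Lambda> \<le> k" "\<beta> * \<nu> / sqrt \<mu> \<le> k"
    "((s + c + T * \<beta>) * \<Lambda> + \<Lambda> * T) / sqrt \<mu> \<le> k"
  proof -
    have "0 < \<beta> * \<nu>" "0 \<le> \<beta> * \<nu> / sqrt \<mu>" "0 \<le> ((s + c + T * \<beta>) * \<Lambda> + \<Lambda> * T) / sqrt \<mu>"
      using \<beta> \<nu> \<mu> s c T \<Lambda> by simp_all
    then show "0 < k" "\<beta> * \<nu> \<le> k" "\<Lambda> \<le> k" "\<beta> * \<nu> / sqrt \<mu> \<le> k"
      "((s + c + T * \<beta>) * \<Lambda> + \<Lambda> * T) / sqrt \<mu> \<le> k"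
      using \<Lambda> unfolding k_def by linarith+
  qed
  obtain Cr where Cr: "0 \<le> Cr"
    "\<And>\<tau> N a b n. \<lbrakk>0 < \<tau>; real N * \<tau> \<le> T; a 0 = 0; b 0 = 0;
      \<And>n. 0 \<le> a n; \<And>n. 0 \<le> b n;
      \<And>n. n < N \<Longrightarrow> a (Suc n) \<le> a n + k * \<tau> * (a n + b n) + k * \<tau>\<^sup>2;
      \<And>n. n < N \<Longrightarrow> b (Suc n) \<le> \<rho> * b n + k * \<tau> * (a n + b n) + k * \<tau>; n \<le> N\<rbrakk>
      \<Longrightarrow> a n \<le> Cr * \<tau> \<and> b n \<le> Cr * \<tau>"
    using coupled_recursion_bound[OF k(1) \<rho> T] by metis
  define Cst where "Cst = \<nu> * (Cr + Cr) + Cr / sqrt \<mu>"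
  show thesis
  proof (rule that[of Cst])
    show "0 \<le> Cst" using Cr \<nu> \<mu> by (simp add: Cst_def)
  next
    fix \<tau> q :: real and N n :: nat and e z w d R :: "nat \<Rightarrow> 'x"
    assume \<tau>: "0 < \<tau>" and N: "real N * \<tau> \<le> T" and q: "0 \<le> q" "q \<le> 1" "q * \<omega> \<le> \<rho>"
      and sys: "splitting_error_system S Cc Bb \<Lambda> \<tau> q N e z w d R" and n: "n \<le> N"
    from sys have e0: "e 0 = 0" and z0: "z 0 = 0"
      and d: "\<And>n. n < N \<Longrightarrow> norm (d n) \<le> \<Lambda> * \<tau>"
      and R: "\<And>n. n < N \<Longrightarrow> norm (R n) \<le> \<Lambda> * \<tau>\<^sup>2"
      and estep: "\<And>n. n < N \<Longrightarrow> S (e (Suc n)) + Cc (e (Suc n)) + \<tau> *\<^sub>R Bb (e (Suc n)) - S (z (Suc n))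
         = S (e n) + Cc (e n) - S (z n) - R n"
      and w: "\<And>n. n < N \<Longrightarrow> Cc (w n) + \<tau> *\<^sub>R Bb (w n)
         = S (d n) + Cc (d n) + \<tau> *\<^sub>R Bb (d n) - R n - \<tau> *\<^sub>R Bb (e n) - S (z n)"
      and zw: "\<And>n. n < N \<Longrightarrow> sqrt (z (Suc n) \<bullet> (Cc (z (Suc n)) + \<tau> *\<^sub>R Bb (z (Suc n))))
         \<le> q * sqrt (w n \<bullet> (Cc (w n) + \<tau> *\<^sub>R Bb (w n)))"
      unfolding splitting_error_system_def by blast+
    define M where "M x = Cc x + \<tau> *\<^sub>R Bb x" for x
    define nM where "nM x = sqrt (x \<bullet> M x)" for x
    have linM: "linear M"
      unfolding M_def by (intro linear_compose_add linear_compose_scale_right lin)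
    have M\<mu>: "\<mu> * (norm x)\<^sup>2 \<le> x \<bullet> M x" and CM: "x \<bullet> Cc x \<le> x \<bullet> M x" for x
      using \<mu>(2)[of x] B0[of x] \<tau> by (simp_all add: M_def inner_simps add_increasing2)
    have Mpos: "0 < x \<bullet> M x" if "x \<noteq> 0" for x
      using C0[OF that] CM[of x] by simp
    have Mnn: "0 \<le> x \<bullet> M x" for x
      using Mpos[of x] by (cases "x = 0") auto
    have normM: "norm x \<le> nM x / sqrt \<mu>" for x
      unfolding nM_def by (rule positive_definite_sqrt_bound[OF \<mu>(1) M\<mu>])
    have SM: "\<bar>x \<bullet> S y\<bar> \<le> \<omega> * (nM x * nM y)" for x y
      unfolding nM_def
    proof (rule form_Cauchy_Schwarz[OF lin(1) linM sym(1) _ Mpos])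
      show "\<bar>x \<bullet> S x\<bar> \<le> \<omega> * (x \<bullet> M x)" for x
        using S0[of x] S1[of x] mult_left_mono[OF CM[of x] \<omega>] by simp
    qed
    \<comment> \<open>Up to \<open>\<tau> *\<^sub>R Bb (e n)\<close>, this is the error of the
      quantity that the scheme carries from one time step to the next, displacement part plus mass
      part; the displacement lags behind by \<open>z\<close>.\<close>
    define v where "v n = S (e n) + M (e n) - S (z n)" for n
    have e_bound: "norm (e n) \<le> \<nu> * (norm (v n) + nM (z n))" for n
    proof (cases "e n = 0")
      case True
      then show ?thesis using \<nu> Mnn by (simp add: nM_def)
    next
      case False
      have "norm (e n) * (\<mu> * norm (e n)) \<le> e n \<bullet> M (e n)"
        using M\<mu>[of "e n"] by (simp add: power2_eq_square mult_ac)
      \<comment> \<open>The form of \<open>S\<close> is nonnegative and may be added on the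
        right.\<close>
      also have "\<dots> \<le> e n \<bullet> (v n + S (z n))"
        using S0[of "e n"] by (simp add: v_def inner_simps)
      also have "\<dots> \<le> norm (e n) * norm (v n + S (z n))"
        by (rule norm_cauchy_schwarz)
      finally have "\<mu> * norm (e n) \<le> norm (v n + S (z n))"
        using False by simp
      also have "\<dots> \<le> norm (v n) + s * norm (z n)"
        using norm_triangle_ineq[of "v n" "S (z n)"] s(2)[of "z n"] by simp
      also have "\<dots> \<le> norm (v n) + s * (nM (z n) / sqrt \<mu>)"
        using mult_left_mono[OF normM[of "z n"], of s] s by simp
      also have "\<dots> \<le> (1 + s / sqrt \<mu>) * (norm (v n) + nM (z n))"
        using s \<mu> Mnn by (simp add: nM_def algebra_simps)
      finally show ?thesis using \<mu> by (simp add: \<nu>_def field_simps)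
    qed
    have \<tau>T: "\<tau> \<le> T" if "j < N" for j
    proof -
      have "1 * \<tau> \<le> real N * \<tau>" using that \<tau> by (intro mult_right_mono) auto
      with N show ?thesis by simp
    qed
    have "norm (v m) \<le> Cr * \<tau> \<and> nM (z m) \<le> Cr * \<tau>" if m: "m \<le> N" for m
    proof (rule Cr(2)[OF \<tau> N, where a = "\<lambda>n. norm (v n)" and b = "\<lambda>n. nM (z n)", OF _ _ _ _ _ _ m])
      show "norm (v 0) = 0" "nM (z 0) = 0"
        using e0 z0 by (simp_all add: v_def nM_def M_def S.zero Cc.zero Bb.zero)
      show "0 \<le> norm (v j)" "0 \<le> nM (z j)" for j
        using Mnn by (simp_all add: nM_def)
      fix j assume j: "j < N"
      have Be: "norm (\<tau> *\<^sub>R Bb (e j)) \<le> \<tau> * (\<beta> * \<nu>) * (norm (v j) + nM (z j))"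
      proof -
        have "norm (Bb (e j)) \<le> \<beta> * (\<nu> * (norm (v j) + nM (z j)))"
          using order_trans[OF \<beta>(2) mult_left_mono[OF e_bound]] \<beta>(1) by simp
        then show ?thesis using \<tau> by (simp add: mult.assoc)
      qed
      have nonneg: "0 \<le> \<tau> * (norm (v j) + nM (z j))"
        using \<tau> Mnn by (simp add: nM_def)
      have "v (Suc j) = v j - \<tau> *\<^sub>R Bb (e j) - R j"
        using estep[OF j] by (simp add: v_def M_def algebra_simps)
      then have "norm (v (Suc j)) \<le> norm (v j) + norm (\<tau> *\<^sub>R Bb (e j)) + norm (R j)"
        using norm_triangle_ineq4[of "v j - \<tau> *\<^sub>R Bb (e j)" "R j"]
          norm_triangle_ineq4[of "v j" "\<tau> *\<^sub>R Bb (e j)"] by simp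
      also have "\<dots> \<le> norm (v j) + k * (\<tau> * (norm (v j) + nM (z j))) + k * \<tau>\<^sup>2"
      proof (intro add_mono order_refl)
        show "norm (\<tau> *\<^sub>R Bb (e j)) \<le> k * (\<tau> * (norm (v j) + nM (z j)))"
          using Be mult_right_mono[OF k(2) nonneg] by (simp add: mult_ac)
        show "norm (R j) \<le> k * \<tau>\<^sup>2"
          using R[OF j] mult_right_mono[OF k(3), of "\<tau>\<^sup>2"] by simp
      qed
      finally show "norm (v (Suc j)) \<le> norm (v j) + k * \<tau> * (norm (v j) + nM (z j)) + k * \<tau>\<^sup>2"
        by (simp add: mult.assoc)
      \<comment> \<open>\<open>\<psi>\<close> is the right-hand side of the equation for
        \<open>w\<close> without the feedback \<open>- S (z j)\<close>. The feedback must keep its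
        exact factor \<open>\<omega>\<close>, while every term of \<open>\<psi>\<close> is bounded
        with a factor \<open>\<tau>\<close>.\<close>
      define \<psi> where "\<psi> = S (d j) + Cc (d j) + \<tau> *\<^sub>R Bb (d j) - R j - \<tau> *\<^sub>R Bb (e j)"
      have "norm (a + b + c - r - s) \<le> norm a + norm b + norm c + norm r + norm s" for a b c r s :: 'x
        by norm
      then have "norm \<psi> \<le> norm (S (d j)) + norm (Cc (d j)) + norm (\<tau> *\<^sub>R Bb (d j)) + norm (R j)
          + norm (\<tau> *\<^sub>R Bb (e j))"
        unfolding \<psi>_def .
      also have "\<dots> \<le> s * (\<Lambda> * \<tau>) + c * (\<Lambda> * \<tau>) + T * (\<beta> * (\<Lambda> * \<tau>)) + \<Lambda> * (T * \<tau>)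
          + \<tau> * (\<beta> * \<nu>) * (norm (v j) + nM (z j))"
      proof (intro add_mono Be)
        note dj = d[OF j]
        show "norm (S (d j)) \<le> s * (\<Lambda> * \<tau>)" 
          using order_trans[OF s(2) mult_left_mono[OF dj]] s(1) by simp
        show "norm (Cc (d j)) \<le> c * (\<Lambda> * \<tau>)" 
          using order_trans[OF c(2) mult_left_mono[OF dj]] c(1) by simp
        have "norm (Bb (d j)) \<le> \<beta> * (\<Lambda> * \<tau>)" 
          using order_trans[OF \<beta>(2) mult_left_mono[OF dj]] \<beta>(1) by simp
        then show "norm (\<tau> *\<^sub>R Bb (d j)) \<le> T * (\<beta> * (\<Lambda> * \<tau>))"
          using \<tau> \<tau>T[OF j] by (simp add: mult_mono)
        \<comment> \<open>First order suffices here, so one power of \<open>\<tau>\<close> is traded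
          for \<open>T\<close>.\<close>
        have "\<Lambda> * \<tau>\<^sup>2 \<le> \<Lambda> * (T * \<tau>)"
          using \<Lambda> \<tau> \<tau>T[OF j] by (simp add: power2_eq_square mult_left_mono)
        then show "norm (R j) \<le> \<Lambda> * (T * \<tau>)" using R[OF j] by simp
      qed
      finally have \<psi>: "norm \<psi> \<le> ((s + c + T * \<beta>) * \<Lambda> + \<Lambda> * T) * \<tau> + \<beta> * \<nu> * (\<tau> * (norm (v j) + nM (z j)))"
        by (simp add: algebra_simps)
      have "norm \<psi> / sqrt \<mu> \<le> (((s + c + T * \<beta>) * \<Lambda> + \<Lambda> * T) / sqrt \<mu>) * \<tau>
          + (\<beta> * \<nu> / sqrt \<mu>) * (\<tau> * (norm (v j) + nM (z j)))"
        using divide_right_mono[OF \<psi>, of "sqrt \<mu>"] \<mu> by (simp add: add_divide_distrib algebra_simps)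
      also have "\<dots> \<le> k * \<tau> + k * (\<tau> * (norm (v j) + nM (z j)))"
        using k(4,5) \<tau> nonneg by (intro add_mono mult_right_mono) auto
      finally have \<psi>k: "norm \<psi> / sqrt \<mu> \<le> k * \<tau> + k * (\<tau> * (norm (v j) + nM (z j)))" .
      \<comment> \<open>\<open>M w = \<psi> - S z\<close> is tested with \<open>w\<close> and
        divided by the norm of \<open>w\<close>. The term with \<open>S\<close> is estimated in the
        norm of \<open>M\<close> throughout, which preserves the factor
        \<open>\<omega>\<close>.\<close>
      have nw: "nM (w j) \<le> \<omega> * nM (z j) + norm \<psi> / sqrt \<mu>"
      proof (cases "w j = 0")
        case True
        then show ?thesis using \<omega> Mnn \<mu> by (simp add: nM_def)
      next
        case False
        have pos: "0 < nM (w j)" using Mpos[OF False] by (simp add: nM_def)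
        have "nM (w j) * nM (w j) = w j \<bullet> M (w j)"
          using Mnn by (simp add: nM_def)
        also have "\<dots> = w j \<bullet> \<psi> - w j \<bullet> S (z j)"
          using w[OF j] by (simp add: M_def \<psi>_def inner_simps)
        also have "\<dots> \<le> norm (w j) * norm \<psi> + \<omega> * (nM (w j) * nM (z j))"
          using SM[of "w j" "z j"] norm_cauchy_schwarz[of "w j" \<psi>] by linarith
        also have "\<dots> \<le> (nM (w j) / sqrt \<mu>) * norm \<psi> + \<omega> * (nM (w j) * nM (z j))"
          using normM[of "w j"] by (intro add_right_mono mult_right_mono) auto
        also have "\<dots> = nM (w j) * (\<omega> * nM (z j) + norm \<psi> / sqrt \<mu>)"
          by (simp add: algebra_simps)
        finally show ?thesis using pos by simp
      qed
      have "nM (z (Suc j)) \<le> q * nM (w j)"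
        using zw[OF j] by (simp add: nM_def M_def)
      also have "\<dots> \<le> (q * \<omega>) * nM (z j) + q * (norm \<psi> / sqrt \<mu>)"
        using mult_left_mono[OF nw q(1)] by (simp add: algebra_simps)
      also have "\<dots> \<le> \<rho> * nM (z j) + 1 * (norm \<psi> / sqrt \<mu>)"
        using q Mnn \<mu> by (intro add_mono mult_right_mono) (auto simp: nM_def)
      finally show "nM (z (Suc j)) \<le> \<rho> * nM (z j) + k * \<tau> * (norm (v j) + nM (z j)) + k * \<tau>"
        using \<psi>k by (simp add: mult.assoc)
    qed
    then have vz: "norm (v n) \<le> Cr * \<tau>" "nM (z n) \<le> Cr * \<tau>"
      using n by auto
    have nn: "0 \<le> Cr * \<tau> / sqrt \<mu>" "0 \<le> \<nu> * (Cr + Cr) * \<tau>"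
      using Cr(1) \<tau> \<mu> \<nu> by auto
    have "norm (e n) \<le> \<nu> * (Cr + Cr) * \<tau>"
      using e_bound[of n] vz mult_left_mono[of "norm (v n) + nM (z n)" "(Cr + Cr) * \<tau>" \<nu>] \<nu>
      by (simp add: algebra_simps)
    moreover have "norm (z n) \<le> Cr * \<tau> / sqrt \<mu>"
      using normM[of "z n"] divide_right_mono[OF vz(2), of "sqrt \<mu>"] \<mu> by simp
    moreover have "Cst * \<tau> = \<nu> * (Cr + Cr) * \<tau> + Cr * \<tau> / sqrt \<mu>"
      by (simp add: Cst_def algebra_simps)
    ultimately show "norm (e n) \<le> Cst * \<tau> \<and> norm (z n) \<le> Cst * \<tau>"
      using nn by linarith
  qed
qed

section \<open>Lipschitz bounds in time, the Euler defect and a uniform rate\<close>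

lemma C1_closed_interval_lipschitz:
  fixes F :: "real \<Rightarrow> 'a::real_normed_vector"
  assumes "Ck_on 1 {0..T} F"
  obtains \<Lambda> where "0 \<le> \<Lambda>"
    and "\<And>s t. \<lbrakk>s \<in> {0..T}; t \<in> {0..T}\<rbrakk> \<Longrightarrow> norm (F t - F s) \<le> \<Lambda> * \<bar>t - s\<bar>"
proof -
  obtain F' where F': "\<And>t. t \<in> {0..T} \<Longrightarrow> (F has_vector_derivative F' t) (at t within {0..T})"
    and cont: "continuous_on {0..T} F'"
    using assms unfolding One_nat_def Ck_on.simps by blast
  have "bounded (F' ` {0..T})"
    using cont by (intro compact_imp_bounded compact_continuous_image) auto
  then obtain \<Lambda> where "0 < \<Lambda>" and \<Lambda>: "\<And>t. t \<in> {0..T} \<Longrightarrow> norm (F' t) \<le> \<Lambda>"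
    by (auto simp: bounded_pos)
  have "norm (F t - F s) \<le> \<Lambda> * \<bar>t - s\<bar>" if "s \<in> {0..T}" "t \<in> {0..T}" for s t
  proof -
    have "norm (F t - F s) \<le> \<Lambda> * norm (t - s)"
    proof (rule differentiable_bound[where S = "{0..T}" and f' = "\<lambda>x h. h *\<^sub>R F' x"])
      show "(F has_derivative (\<lambda>h. h *\<^sub>R F' x)) (at x within {0..T})" if "x \<in> {0..T}" for x
        using F'[OF that] by (simp add: has_vector_derivative_def)
      show "onorm (\<lambda>h. h *\<^sub>R F' x) \<le> \<Lambda>" if "x \<in> {0..T}" for x
        using \<Lambda>[OF that] by (intro onorm_le) (simp add: mult.commute[of \<Lambda>] mult_left_mono)
    qed (use that in auto)
    then show ?thesis by simp
  qed
  then show thesis using \<open>0 < \<Lambda>\<close> that[of \<Lambda>] by simp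
qed

text \<open>The mean value inequality is applied to \<open>Y\<close> minus its linearization with
  the slope at the right end point. Regularity enters as a Lipschitz bound on \<open>\<phi>\<close>,
  since the evolution equation expresses this derivative by loads and stiffness term.\<close>

lemma backward_Euler_defect:
  fixes Y \<phi> :: "real \<Rightarrow> 'a::real_normed_vector"
  assumes deriv: "\<And>t. t \<in> {0..T} \<Longrightarrow> (Y has_vector_derivative \<phi> t) (at t within {0..T})"
    and lip: "\<And>s t. \<lbrakk>s \<in> {0..T}; t \<in> {0..T}\<rbrakk> \<Longrightarrow> norm (\<phi> t - \<phi> s) \<le> \<Lambda> * \<bar>t - s\<bar>"
    and \<Lambda>: "0 \<le> \<Lambda>" and ab: "0 \<le> a" "a \<le> b" "b \<le> T"
  shows "norm (Y b - Y a - (b - a) *\<^sub>R \<phi> b) \<le> \<Lambda> * (b - a)\<^sup>2"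
proof -
  have seg: "closed_segment a b = {a..b}" using ab by (simp add: closed_segment_eq_real_ivl)
  have "norm (Y b - Y a - (b - a) *\<^sub>R \<phi> b) \<le> norm (b - a) * (\<Lambda> * (b - a))"
  proof (rule vector_differentiable_bound_linearization[where S = "{a..b}" and f' = \<phi>])
    show "(Y has_vector_derivative \<phi> x) (at x within {a..b})" if "x \<in> {a..b}" for x
      using that ab by (intro has_vector_derivative_within_subset[OF deriv]) auto
    show "norm (\<phi> x - \<phi> b) \<le> \<Lambda> * (b - a)" if "x \<in> {a..b}" for x
    proof -
      have "norm (\<phi> x - \<phi> b) \<le> \<Lambda> * \<bar>x - b\<bar>" using that ab by (intro lip) auto
      also have "\<dots> \<le> \<Lambda> * (b - a)" using that ab \<Lambda> by (intro mult_left_mono) auto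
      finally show ?thesis .
    qed
  qed (use seg ab in auto)
  then show ?thesis using ab by (simp add: power2_eq_square mult_ac)
qed

text \<open>The error constant is chosen before \<open>K\<close>, so one rate has to serve all
  admissible \<open>K\<close>. As \<open>\<omega> / (2 + \<omega>) \<le> 1\<close>, the factor does
  not grow with \<open>K\<close>, and the least admissible \<open>K\<close> gives the worst
  rate.\<close>

lemma uniform_iteration_rate:
  fixes \<omega> :: real
  assumes "0 \<le> \<omega>"
  obtains \<rho> where "0 \<le> \<rho>" and "\<rho> < 1"
    and "\<And>K. \<lbrakk>1 \<le> K; \<omega> ^ K / (2 + \<omega>) ^ (K - 1) < 1\<rbrakk> \<Longrightarrow> (\<omega> / (2 + \<omega>)) ^ (K - 1) * \<omega> \<le> \<rho>"
proof -
  define q where "q = \<omega> / (2 + \<omega>)"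
  define V where "V K \<longleftrightarrow> 1 \<le> K \<and> \<omega> ^ K / (2 + \<omega>) ^ (K - 1) < 1" for K :: nat
  have q: "0 \<le> q" "q \<le> 1" using assms by (auto simp: q_def)
  have eq: "\<omega> ^ K / (2 + \<omega>) ^ (K - 1) = q ^ (K - 1) * \<omega>" if "1 \<le> K" for K
    using that by (cases K) (auto simp: q_def power_divide)
  show thesis
  proof (cases "\<exists>K. V K")
    case True
    define K\<^sub>0 where "K\<^sub>0 = (LEAST K. V K)"
    have "V K\<^sub>0" using True unfolding K\<^sub>0_def by (metis LeastI)
    show thesis
    proof (rule that[of "q ^ (K\<^sub>0 - 1) * \<omega>"])
      show "0 \<le> q ^ (K\<^sub>0 - 1) * \<omega>" using q assms by simp
      show "q ^ (K\<^sub>0 - 1) * \<omega> < 1" using \<open>V K\<^sub>0\<close> eq[of K\<^sub>0] by (simp add: V_def)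
      fix K assume "1 \<le> K" "\<omega> ^ K / (2 + \<omega>) ^ (K - 1) < 1"
      then have "K\<^sub>0 \<le> K" unfolding K\<^sub>0_def V_def by (intro Least_le) simp
      then have "q ^ (K - 1) \<le> q ^ (K\<^sub>0 - 1)" using q by (intro power_decreasing) auto
      then show "(\<omega> / (2 + \<omega>)) ^ (K - 1) * \<omega> \<le> q ^ (K\<^sub>0 - 1) * \<omega>"
        using assms unfolding q_def by (rule mult_right_mono)
    qed
  next
    case False
    then show thesis by (intro that[of 0]) (auto simp: V_def)
  qed
qed

section \<open>First-order convergence for general block operators\<close>

text \<open>Pressure and temperature form one unknown \<open>x\<close>, and maps take the place of
  matrices because the block operators act on pairs. Only \<open>N\<close> steps are constrained, so
  all times stay in \<open>[0, T]\<close> when \<open>real N * \<tau> \<le> T\<close>.\<close>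

definition decoupled_scheme ::
  "('v::real_vector \<Rightarrow> 'v) \<Rightarrow> ('v \<Rightarrow> 'x::real_vector) \<Rightarrow> ('x \<Rightarrow> 'v) \<Rightarrow> ('x \<Rightarrow> 'x) \<Rightarrow> ('x \<Rightarrow> 'x) \<Rightarrow>
   (real \<Rightarrow> 'v) \<Rightarrow> (real \<Rightarrow> 'x) \<Rightarrow> real \<Rightarrow> real \<Rightarrow> nat \<Rightarrow> nat \<Rightarrow>
   (nat \<Rightarrow> 'v) \<Rightarrow> (nat \<Rightarrow> 'x) \<Rightarrow> (nat \<Rightarrow> nat \<Rightarrow> 'v) \<Rightarrow> (nat \<Rightarrow> nat \<Rightarrow> 'x) \<Rightarrow> (nat \<Rightarrow> nat \<Rightarrow> 'x) \<Rightarrow> bool" where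
  "decoupled_scheme A D Dt Cc Bb f G \<gamma> \<tau> K N U x uk xk xh \<longleftrightarrow> A (U 0) = Dt (x 0) + f 0 \<and>
     (\<forall>n<N. xk n 0 = x n \<and>
        (\<forall>k<K. A (uk n (Suc k)) = Dt (xk n k) + f (real (Suc n) * \<tau>) \<and>
           D (uk n (Suc k)) + (Cc (xh n (Suc k)) + \<tau> *\<^sub>R Bb (xh n (Suc k)))
             = D (U n) + Cc (x n) + \<tau> *\<^sub>R G (real (Suc n) * \<tau>)) \<and>
        (\<forall>k. Suc k < K \<longrightarrow> xk n (Suc k) = \<gamma> *\<^sub>R xh n (Suc k) + (1 - \<gamma>) *\<^sub>R xk n k) \<and>
        U (Suc n) = uk n K \<and> x (Suc n) = xh n K)"

text \<open>Eliminating the displacement turns the exact equations and the scheme into equations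
  with \<open>S\<close> for \<open>x\<close> alone, whose difference is a
  \<open>splitting_error_system\<close>; the load \<open>f\<close> enters both through the same term
  \<open>F\<close> and cancels.\<close>

lemma decoupled_scheme_first_order:
  fixes A Ai :: "'v::euclidean_space \<Rightarrow> 'v" and D :: "'v \<Rightarrow> 'x::euclidean_space" and Dt :: "'x \<Rightarrow> 'v"
    and Cc Bb :: "'x \<Rightarrow> 'x" and f u :: "real \<Rightarrow> 'v" and G X \<phi> :: "real \<Rightarrow> 'x"
  assumes lin: "linear A" "linear Ai" "linear D" "linear Dt" "linear Cc" "linear Bb"
    and inv: "\<And>v. A (Ai v) = v" "\<And>v. Ai (A v) = v"
    and adj: "\<And>x v. x \<bullet> D v = Dt x \<bullet> v"
    and sym: "\<And>x y. x \<bullet> A y = A x \<bullet> y" "\<And>x y. x \<bullet> Cc y = Cc x \<bullet> y" "\<And>x y. x \<bullet> Bb y = Bb x \<bullet> y"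
    and A0: "\<And>v. 0 \<le> v \<bullet> A v" and C0: "\<And>x. x \<noteq> 0 \<Longrightarrow> 0 < x \<bullet> Cc x" and B0: "\<And>x. 0 \<le> x \<bullet> Bb x"
    and \<omega>: "0 \<le> \<omega>" and S1: "\<And>x. x \<bullet> D (Ai (Dt x)) \<le> \<omega> * (x \<bullet> Cc x)"
    and T: "0 < T" and \<Lambda>: "0 \<le> \<Lambda>"
    and eq1: "\<And>t. t \<in> {0..T} \<Longrightarrow> A (u t) = Dt (X t) + f t"
    and eq2: "\<And>t. t \<in> {0..T} \<Longrightarrow>
      ((\<lambda>t. D (u t) + Cc (X t)) has_vector_derivative G t - Bb (X t)) (at t within {0..T})"
    and lipX: "\<And>s t. \<lbrakk>s \<in> {0..T}; t \<in> {0..T}\<rbrakk> \<Longrightarrow> norm (X t - X s) \<le> \<Lambda> * \<bar>t - s\<bar>"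
    and lipG: "\<And>s t. \<lbrakk>s \<in> {0..T}; t \<in> {0..T}\<rbrakk> \<Longrightarrow>
      norm ((G t - Bb (X t)) - (G s - Bb (X s))) \<le> \<Lambda> * \<bar>t - s\<bar>"
  obtains Cst where "0 \<le> Cst"
    and "\<And>\<tau> K N U x uk xk xh. \<lbrakk>0 < \<tau>; 1 \<le> K; \<omega> ^ K / (2 + \<omega>) ^ (K - 1) < 1; real N * \<tau> \<le> T; x 0 = X 0;
      decoupled_scheme A D Dt Cc Bb f G (2 / (2 + \<omega>)) \<tau> K N U x uk xk xh\<rbrakk>
      \<Longrightarrow> norm (x N - X (real N * \<tau>)) \<le> Cst * \<tau> \<and> norm (U N - u (real N * \<tau>)) \<le> Cst * \<tau>"
proof -
  interpret A: linear A by fact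
  interpret Ai: linear Ai by fact
  interpret D: linear D by fact
  interpret Dt: linear Dt by fact
  interpret Cc: linear Cc by fact
  interpret Bb: linear Bb by fact
  define S where "S x = D (Ai (Dt x))" for x
  have linS: "linear S"
    using linear_compose[OF linear_compose[OF lin(4) lin(2)] lin(3)] by (simp add: S_def[abs_def] o_def)
  interpret S: linear S by fact
  \<comment> \<open>\<open>S\<close> is the energy form of \<open>A\<close> at the displacements
    induced by \<open>x\<close> and \<open>y\<close>, so symmetry and nonnegativity carry over from
    \<open>A\<close>.\<close>
  have S_form: "x \<bullet> S y = Ai (Dt x) \<bullet> A (Ai (Dt y))" for x y
    by (metis S_def adj sym(1) inv(1))
  have S_sym: "x \<bullet> S y = S x \<bullet> y" for x y
    by (metis S_form sym(1) inner_commute)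
  have S0: "0 \<le> x \<bullet> S x" for x by (simp add: S_form A0)
  have S1': "x \<bullet> S x \<le> \<omega> * (x \<bullet> Cc x)" for x unfolding S_def by (rule S1)
  obtain \<rho> where \<rho>: "0 \<le> \<rho>" "\<rho> < 1"
    "\<And>K. \<lbrakk>1 \<le> K; \<omega> ^ K / (2 + \<omega>) ^ (K - 1) < 1\<rbrakk> \<Longrightarrow> (\<omega> / (2 + \<omega>)) ^ (K - 1) * \<omega> \<le> \<rho>"
    using uniform_iteration_rate[OF \<omega>] by metis
  obtain Cx where Cx: "0 \<le> Cx" and Cx_bound:
    "\<And>\<tau> q N e z w d R n. \<lbrakk>0 < \<tau>; real N * \<tau> \<le> T; 0 \<le> q; q \<le> 1; q * \<omega> \<le> \<rho>;
      splitting_error_system S Cc Bb \<Lambda> \<tau> q N e z w d R; n \<le> N\<rbrakk>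
      \<Longrightarrow> norm (e n) \<le> Cx * \<tau> \<and> norm (z n) \<le> Cx * \<tau>"
    using splitting_error_bound[OF linS lin(5,6) S_sym sym(2,3) S0 S1' C0 B0 \<omega> \<rho>(1,2) T \<Lambda>] by metis
  have "linear (\<lambda>x. Ai (Dt x))"
    using linear_compose[OF lin(4) lin(2)] by (simp add: o_def)
  then obtain j where j: "0 < j" "\<And>x. norm (Ai (Dt x)) \<le> j * norm x"
    using linear_bounded_pos by blast
  define F where "F t = D (Ai (f t))" for t
  have u_eq: "u t = Ai (Dt (X t) + f t)" if "t \<in> {0..T}" for t
    using eq1[OF that] inv(2)[of "u t"] by simp
  have Du: "D (u t) = S (X t) + F t" if "t \<in> {0..T}" for t
    by (simp add: u_eq[OF that] S_def F_def Ai.add D.add)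
  show thesis
  \<comment> \<open>The second summand serves the displacement, whose error is
    \<open>Ai (Dt (e N - z N))\<close>.\<close>
  proof (rule that[of "Cx + j * (Cx + Cx)"])
    show "0 \<le> Cx + j * (Cx + Cx)" using Cx j by simp
    fix \<tau> :: real and K N :: nat and U :: "nat \<Rightarrow> 'v" and x :: "nat \<Rightarrow> 'x"
      and uk :: "nat \<Rightarrow> nat \<Rightarrow> 'v" and xk xh :: "nat \<Rightarrow> nat \<Rightarrow> 'x"
    assume \<tau>: "0 < \<tau>" and K: "1 \<le> K" "\<omega> ^ K / (2 + \<omega>) ^ (K - 1) < 1" and N: "real N * \<tau> \<le> T"
      and x0: "x 0 = X 0" and scheme: "decoupled_scheme A D Dt Cc Bb f G (2 / (2 + \<omega>)) \<tau> K N U x uk xk xh"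
    from scheme have U0: "A (U 0) = Dt (x 0) + f 0"
      and xk0: "\<And>n. n < N \<Longrightarrow> xk n 0 = x n"
      and uk: "\<And>n k. \<lbrakk>n < N; k < K\<rbrakk> \<Longrightarrow> A (uk n (Suc k)) = Dt (xk n k) + f (real (Suc n) * \<tau>)"
      and xh: "\<And>n k. \<lbrakk>n < N; k < K\<rbrakk> \<Longrightarrow>
          D (uk n (Suc k)) + (Cc (xh n (Suc k)) + \<tau> *\<^sub>R Bb (xh n (Suc k)))
          = D (U n) + Cc (x n) + \<tau> *\<^sub>R G (real (Suc n) * \<tau>)"
      and damp: "\<And>n k. \<lbrakk>n < N; Suc k < K\<rbrakk> \<Longrightarrow>
          xk n (Suc k) = (2 / (2 + \<omega>)) *\<^sub>R xh n (Suc k) + (1 - 2 / (2 + \<omega>)) *\<^sub>R xk n k"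
      and US: "\<And>n. n < N \<Longrightarrow> U (Suc n) = uk n K" and xS: "\<And>n. n < N \<Longrightarrow> x (Suc n) = xh n K"
      unfolding decoupled_scheme_def by blast+
    define t where "t n = real n * \<tau>" for n
    define q where "q = (\<omega> / (2 + \<omega>)) ^ (K - 1)"
    have q: "0 \<le> q" "q \<le> 1" "q * \<omega> \<le> \<rho>"
      using \<omega> \<rho>(3)[OF K] by (auto simp: q_def intro!: power_le_one)
    have t: "t n \<in> {0..T}" if "n \<le> N" for n
    proof -
      have "real n * \<tau> \<le> real N * \<tau>" using that \<tau> by (intro mult_right_mono) auto
      then have "real n * \<tau> \<le> T" using N by (rule order_trans)
      then show ?thesis using \<tau> by (simp add: t_def)
    qed
    have tS: "t (Suc n) - t n = \<tau>" for n by (simp add: t_def algebra_simps)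
    \<comment> \<open>The displacement of a time step belongs to the iterate
      \<open>xk m (K - 1)\<close> that entered the last inner solve, hence to
      \<open>x n - z n\<close>. The initial displacement is consistent with \<open>x 0\<close>,
      hence the value 0 there.\<close>
    define z where "z n = (case n of 0 \<Rightarrow> 0 | Suc m \<Rightarrow> x n - xk m (K - 1))" for n
    define e where "e n = x n - X (t n)" for n
    define d where "d n = X (t (Suc n)) - X (t n)" for n
    define w where "w n = xh n (Suc 0) - xk n 0" for n
    define Y where "Y s = D (u s) + Cc (X s)" for s
    define R where "R n = Y (t (Suc n)) - Y (t n) - \<tau> *\<^sub>R (G (t (Suc n)) - Bb (X (t (Suc n))))" for n
    have U_eq: "U n = Ai (Dt (x n - z n) + f (t n))" if "n \<le> N" for n
    proof (cases n)
      case 0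
      then show ?thesis using U0 inv(2)[of "U 0"] by (simp add: z_def t_def)
    next
      case (Suc m)
      then have m: "m < N" using that by simp
      have "A (U n) = Dt (xk m (K - 1)) + f (t n)"
        using uk[OF m, of "K - 1"] K US[OF m] Suc by (simp add: t_def)
      then show ?thesis using inv(2)[of "U n"] Suc by (simp add: z_def)
    qed
    have DU: "D (U n) = S (x n) - S (z n) + F (t n)" if "n \<le> N" for n
      by (simp add: U_eq[OF that] S_def F_def Ai.add D.add Dt.diff Ai.diff D.diff)
    have Duk: "D (uk n (Suc k)) = S (xk n k) + F (t (Suc n))" if "n < N" "k < K" for n k
      by (metis uk[OF that] inv(2) Ai.add D.add S_def F_def t_def)
    \<comment> \<open>The definition of \<open>R\<close> is arranged like the equation of the
      scheme, so that subtraction leaves only errors and the defect.\<close>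
    have Rn: "S (X (t (Suc n))) + F (t (Suc n)) + Cc (X (t (Suc n)))
        = S (X (t n)) + F (t n) + Cc (X (t n)) + \<tau> *\<^sub>R G (t (Suc n)) - \<tau> *\<^sub>R Bb (X (t (Suc n))) + R n"
      if "n < N" for n
      using Du[OF t, of n] Du[OF t, of "Suc n"] that
      by (simp add: R_def Y_def algebra_simps)
    have "splitting_error_system S Cc Bb \<Lambda> \<tau> q N e z w d R"
      unfolding splitting_error_system_def
    proof (intro conjI allI impI)
      show "e 0 = 0" "z 0 = 0" by (simp_all add: e_def z_def t_def x0)
      fix n assume n: "n < N"
      show "norm (d n) \<le> \<Lambda> * \<tau>"
        using lipX[OF t[of n] t[of "Suc n"]] n \<tau> by (simp add: d_def tS)
      show "norm (R n) \<le> \<Lambda> * \<tau>\<^sup>2"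
        using backward_Euler_defect[OF eq2 lipG \<Lambda>, of "t n" "t (Suc n)"] t[of n] t[of "Suc n"] n \<tau> tS[of n]
        by (simp add: R_def Y_def)
      have "S (xk n (K - 1)) + F (t (Suc n)) + (Cc (x (Suc n)) + \<tau> *\<^sub>R Bb (x (Suc n)))
          = S (x n) - S (z n) + F (t n) + Cc (x n) + \<tau> *\<^sub>R G (t (Suc n))"
        using xh[OF n, of "K - 1"] Duk[OF n, of "K - 1"] DU[of n] n K xS[OF n] by (simp add: t_def)
      moreover have "xk n (K - 1) = x (Suc n) - z (Suc n)" by (simp add: z_def)
      ultimately have "S (x (Suc n)) - S (z (Suc n)) + F (t (Suc n)) + (Cc (x (Suc n)) + \<tau> *\<^sub>R Bb (x (Suc n)))
          = S (x n) - S (z n) + F (t n) + Cc (x n) + \<tau> *\<^sub>R G (t (Suc n))"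
        by (simp add: S.diff)
      from arg_cong2[where f = "(-)", OF this Rn[OF n]]
      show "S (e (Suc n)) + Cc (e (Suc n)) + \<tau> *\<^sub>R Bb (e (Suc n)) - S (z (Suc n))
          = S (e n) + Cc (e n) - S (z n) - R n"
        unfolding e_def by (simp add: S.diff Cc.diff Bb.diff scaleR_diff_right algebra_simps)
      \<comment> \<open>The first inner solve starts from the old value, so \<open>S (x n)\<close>
        stands on both sides and only the lag \<open>- S (z n)\<close> of the preceding step
        survives.\<close>
      have "S (x n) + F (t (Suc n)) + (Cc (xh n (Suc 0)) + \<tau> *\<^sub>R Bb (xh n (Suc 0)))
          = S (x n) - S (z n) + F (t n) + Cc (x n) + \<tau> *\<^sub>R G (t (Suc n))"
        using xh[OF n, of 0] Duk[OF n, of 0] DU[of n] n K xk0[OF n] by (simp add: t_def)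
      from arg_cong2[where f = "(-)", OF this Rn[OF n]]
      show "Cc (w n) + \<tau> *\<^sub>R Bb (w n)
          = S (d n) + Cc (d n) + \<tau> *\<^sub>R Bb (d n) - R n - \<tau> *\<^sub>R Bb (e n) - S (z n)"
        unfolding e_def w_def d_def xk0[OF n]
        by (simp add: S.diff Cc.diff Bb.diff scaleR_diff_right algebra_simps)
      define M where "M x = Cc x + \<tau> *\<^sub>R Bb x" for x
      have "linear M"
        unfolding M_def by (intro linear_compose_add linear_compose_scale_right lin)
      moreover have "y \<bullet> M y' = M y \<bullet> y'" for y y' by (simp add: M_def inner_simps sym)
      moreover have CM: "y \<bullet> Cc y \<le> y \<bullet> M y" for y
        using B0[of y] \<tau> by (simp add: M_def inner_simps)
      moreover have "0 < y \<bullet> M y" if "y \<noteq> 0" for y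
        using C0[OF that] CM[of y] by simp
      moreover have "y \<bullet> S y \<le> \<omega> * (y \<bullet> M y)" for y
        using S1'[of y] mult_left_mono[OF CM[of y] \<omega>] by simp
      moreover have "M (xh n (Suc k)) = (D (U n) + Cc (x n) + \<tau> *\<^sub>R G (t (Suc n)) - F (t (Suc n))) - S (xk n k)"
        if "k < K" for k
        using xh[OF n that] Duk[OF n that] by (simp add: M_def t_def algebra_simps)
      \<comment> \<open>The datum of the inner iteration does not depend on \<open>k\<close>, and
        \<open>K - 1\<close> contractions lead from the first increment \<open>w n\<close> to the
        last one, \<open>z (Suc n)\<close>.\<close>
      ultimately have "sqrt ((xh n (Suc (K - 1)) - xk n (K - 1)) \<bullet> M (xh n (Suc (K - 1)) - xk n (K - 1)))
          \<le> (\<omega> / (2 + \<omega>)) ^ (K - 1) * sqrt ((xh n (Suc 0) - xk n 0) \<bullet> M (xh n (Suc 0) - xk n 0))"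
        using K by (intro relaxed_iteration_contraction[where S = S and K = K
              and xh = "xh n" and x = "xk n" and k = "K - 1", OF _ linS _ S_sym _ S0 _ \<omega> refl _ damp[OF n]]) auto
      then show "sqrt (z (Suc n) \<bullet> (Cc (z (Suc n)) + \<tau> *\<^sub>R Bb (z (Suc n))))
          \<le> q * sqrt (w n \<bullet> (Cc (w n) + \<tau> *\<^sub>R Bb (w n)))"
        using K xS[OF n] by (simp add: z_def w_def q_def M_def)
    qed
    then have e: "norm (e N) \<le> Cx * \<tau>" and z: "norm (z N) \<le> Cx * \<tau>"
      using Cx_bound[OF \<tau> N q] by blast+
    have "U N - u (t N) = Ai (Dt (e N - z N))"
      by (simp add: U_eq u_eq[OF t] e_def Ai.add Ai.diff Dt.diff)
    then have "norm (U N - u (t N)) \<le> j * norm (e N - z N)"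
      using j(2)[of "e N - z N"] by simp
    also have "\<dots> \<le> j * ((Cx + Cx) * \<tau>)"
      using norm_triangle_ineq4[of "e N" "z N"] e z j by (intro mult_left_mono) (auto simp: distrib_right)
    finally have "norm (U N - u (t N)) \<le> j * ((Cx + Cx) * \<tau>)" .
    moreover have "0 \<le> Cx * \<tau>" "0 \<le> j * ((Cx + Cx) * \<tau>)" using Cx \<tau> j by auto
    ultimately show "norm (x N - X (real N * \<tau>)) \<le> (Cx + j * (Cx + Cx)) * \<tau>
        \<and> norm (U N - u (real N * \<tau>)) \<le> (Cx + j * (Cx + Cx)) * \<tau>"
      using e unfolding e_def t_def distrib_right mult.assoc by (intro conjI; linarith)
  qed
qed

section \<open>Regularity classes and matrix estimates\<close>

lemma Ck_on_Suc_imp_Ck_on: "Ck_on (Suc k) S F \<Longrightarrow> Ck_on k S F"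
proof (induction k arbitrary: F)
  case 0
  then obtain F' where "\<And>t. t \<in> S \<Longrightarrow> (F has_vector_derivative F' t) (at t within S)"
    by auto
  then show ?case
    by (auto simp: continuous_on_eq_continuous_within intro: has_vector_derivative_continuous)
next
  case (Suc k)
  then show ?case by (metis Ck_on.simps(2))
qed

lemma C2_imp_C1: "Ck_on 2 S F \<Longrightarrow> Ck_on 1 S F"
  using Ck_on_Suc_imp_Ck_on[of 1 S F] by (simp add: numeral_2_eq_2)

lemma C1_has_vector_derivative:
  assumes "Ck_on 1 {0..T} F" and "0 < T" and "t \<in> {0..T}"
  shows "(F has_vector_derivative vector_derivative F (at t within {0..T})) (at t within {0..T})"
proof -
  obtain F' where "(F has_vector_derivative F' t) (at t within {0..T})"
    using assms(1,3) unfolding One_nat_def Ck_on.simps by blast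
  then have "F differentiable (at t within {0..T})"
    by (rule differentiableI_vector)
  then show ?thesis by (simp add: vector_derivative_works)
qed

lemma inner_matrix_transpose:
  fixes M :: "real^'m^'n"
  shows "x \<bullet> (M *v y) = (transpose M *v x) \<bullet> y"
  by (simp add: transpose_matrix_vector dot_lmul_matrix)

lemma elliptic_positive:
  fixes M N :: "real^'n^'n"
  assumes "sym_pos_def N" and "elliptic N M c" and "x \<noteq> 0"
  shows "0 < x \<bullet> (M *v x)"
proof -
  have "0 < wnorm N x"
    using assms by (simp add: sym_pos_def_def wnorm_def)
  then have "0 < c * (wnorm N x)\<^sup>2"
    using assms by (simp add: elliptic_def)
  also have "\<dots> \<le> x \<bullet> (M *v x)"
    using assms by (simp add: elliptic_def)
  finally show ?thesis .
qed

lemma positive_form_imp_invertible: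
  fixes A :: "real^'n^'n"
  assumes "\<And>x. x \<noteq> 0 \<Longrightarrow> 0 < x \<bullet> (A *v x)"
  shows "invertible A"
proof -
  have "x = 0" if "A *v x = 0" for x
    using assms[of x] that by fastforce
  then have "\<exists>B. B ** A = mat 1"
    by (subst matrix_left_invertible_ker) blast
  then show ?thesis
    by (simp add: invertible_left_inverse)
qed

lemma wnorm_square_bound:
  fixes M :: "real^'n^'n"
  obtains k where "0 \<le> k" and "\<And>x. (wnorm M x)\<^sup>2 \<le> k * (norm x)\<^sup>2"
proof -
  obtain k where k: "0 < k" "\<And>x. norm (M *v x) \<le> k * norm x"
    using linear_bounded_pos[OF matrix_vector_mul_linear] by metis
  have "(wnorm M x)\<^sup>2 \<le> k * (norm x)\<^sup>2" for x
  proof -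
    \<comment> \<open>\<open>sqrt\<close> is continued to negative reals as an odd function, so the
      square is the absolute value of the form for every matrix.\<close>
    have "(wnorm M x)\<^sup>2 = \<bar>x \<bullet> (M *v x)\<bar>"
      by (simp add: wnorm_def power2_eq_square)
    also have "\<dots> \<le> norm x * norm (M *v x)"
      by (rule Cauchy_Schwarz_ineq2)
    also have "\<dots> \<le> norm x * (k * norm x)"
      using k by (intro mult_left_mono) auto
    finally show ?thesis by (simp add: power2_eq_square mult_ac)
  qed
  then show thesis using k that[of k] by simp
qed

text \<open>Nonnegativity of the form at \<open>a - b\<close> bounds the cross term by
  \<open>ch\<^sub>0\<close> times the sum of both squares, which leaves
  \<open>c\<^sub>0 - ch\<^sub>0\<close> and \<open>ct\<^sub>0 - ch\<^sub>0\<close> as coefficients.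
  This is the origin of the minimum in \<open>omega_HD\<close>.\<close>

lemma mass_form_lower_bound:
  fixes N\<^sub>H :: "real^'p^'p"
  assumes "sym_pos_def N\<^sub>H" and "0 < ch\<^sub>0"
  shows "min (c\<^sub>0 - ch\<^sub>0) (ct\<^sub>0 - ch\<^sub>0) * ((wnorm N\<^sub>H a)\<^sup>2 + (wnorm N\<^sub>H b)\<^sup>2)
    \<le> a \<bullet> ((c\<^sub>0 *\<^sub>R N\<^sub>H) *v a - (ch\<^sub>0 *\<^sub>R N\<^sub>H) *v b) + b \<bullet> ((ct\<^sub>0 *\<^sub>R N\<^sub>H) *v b - (ch\<^sub>0 *\<^sub>R N\<^sub>H) *v a)"
proof -
  have nn: "0 \<le> x \<bullet> (N\<^sub>H *v x)" for x
    using assms(1) unfolding sym_pos_def_def by (cases "x = 0") (auto simp: less_imp_le)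
  define P Q where "P = a \<bullet> (N\<^sub>H *v a)" and "Q = b \<bullet> (N\<^sub>H *v b)"
  have "a \<bullet> (N\<^sub>H *v b) = b \<bullet> (N\<^sub>H *v a)"
    using assms(1) by (metis inner_matrix_transpose inner_commute sym_pos_def_def)
  moreover have "0 \<le> (a - b) \<bullet> (N\<^sub>H *v (a - b))" by (rule nn)
  ultimately have ab: "2 * (a \<bullet> (N\<^sub>H *v b)) \<le> P + Q" "b \<bullet> (N\<^sub>H *v a) = a \<bullet> (N\<^sub>H *v b)"
    by (simp_all add: P_def Q_def matrix_vector_mult_diff_distrib inner_simps)
  have "min (c\<^sub>0 - ch\<^sub>0) (ct\<^sub>0 - ch\<^sub>0) * (P + Q) \<le> (c\<^sub>0 - ch\<^sub>0) * P + (ct\<^sub>0 - ch\<^sub>0) * Q"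
    unfolding distrib_left P_def Q_def by (intro add_mono mult_right_mono nn) auto
  also have "\<dots> \<le> c\<^sub>0 * P + ct\<^sub>0 * Q - ch\<^sub>0 * (2 * (a \<bullet> (N\<^sub>H *v b)))"
    using mult_left_mono[OF ab(1), of ch\<^sub>0] assms(2) by (simp add: algebra_simps)
  also have "\<dots> = a \<bullet> ((c\<^sub>0 *\<^sub>R N\<^sub>H) *v a - (ch\<^sub>0 *\<^sub>R N\<^sub>H) *v b) + b \<bullet> ((ct\<^sub>0 *\<^sub>R N\<^sub>H) *v b - (ch\<^sub>0 *\<^sub>R N\<^sub>H) *v a)"
    by (simp add: P_def Q_def scaleR_matrix_vector_assoc[symmetric] inner_simps ab(2))
  finally show ?thesis
    by (simp add: P_def Q_def wnorm_def nn)
qed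

text \<open>As \<open>v\<close> is the displacement induced by \<open>a\<close> and
  \<open>b\<close>, the left-hand side is the energy of \<open>v\<close>. Continuity bounds it
  linearly in the norm of \<open>v\<close>, and ellipticity bounds the square of that norm by the
  energy; eliminating the norm of \<open>v\<close> gives the claim.\<close>

lemma coupling_form_bound:
  fixes A N\<^sub>V :: "real^'u^'u" and N\<^sub>H :: "real^'p^'p" and D Dt :: "real^'u^'p"
  assumes "sym_pos_def N\<^sub>V" and A: "elliptic N\<^sub>V A c\<^sub>a"
    and D: "continuous_to_dual N\<^sub>V N\<^sub>H D C\<^sub>d" and Dt: "continuous_to_dual N\<^sub>V N\<^sub>H Dt Ct\<^sub>d"
    and v: "A *v v = transpose D *v a + transpose Dt *v b"
  shows "a \<bullet> (D *v v) + b \<bullet> (Dt *v v)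
    \<le> (C\<^sub>d\<^sup>2 + Ct\<^sub>d\<^sup>2) / c\<^sub>a * ((wnorm N\<^sub>H a)\<^sup>2 + (wnorm N\<^sub>H b)\<^sup>2)"
proof -
  define P Q V s where "P = wnorm N\<^sub>H a" and "Q = wnorm N\<^sub>H b" and "V = wnorm N\<^sub>V v"
    and "s = a \<bullet> (D *v v) + b \<bullet> (Dt *v v)"
  have c: "0 < c\<^sub>a" using A by (simp add: elliptic_def)
  have "s = v \<bullet> (A *v v)"
    by (simp add: s_def inner_matrix_transpose[of _ D] inner_matrix_transpose[of _ Dt] v inner_simps inner_commute)
  then have sV: "c\<^sub>a * V\<^sup>2 \<le> s" using A by (simp add: elliptic_def V_def)
  then have s0: "0 \<le> s" using c by (meson mult_nonneg_nonneg order_trans less_imp_le zero_le_power2)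
  have "s \<le> C\<^sub>d * V * P + Ct\<^sub>d * V * Q"
    using D Dt unfolding s_def P_def Q_def V_def continuous_to_dual_def
    by (intro add_mono) (meson abs_le_D1)+
  then have "s\<^sup>2 \<le> ((C\<^sub>d * P + Ct\<^sub>d * Q) * V)\<^sup>2"
    using s0 by (intro power_mono) (auto simp: algebra_simps)
  also have "\<dots> \<le> ((C\<^sub>d\<^sup>2 + Ct\<^sub>d\<^sup>2) * (P\<^sup>2 + Q\<^sup>2)) * V\<^sup>2"
  proof -
    \<comment> \<open>Lagrange's identity, which gives the Cauchy-Schwarz inequality in the
      plane.\<close>
    have "(C\<^sub>d\<^sup>2 + Ct\<^sub>d\<^sup>2) * (P\<^sup>2 + Q\<^sup>2) - (C\<^sub>d * P + Ct\<^sub>d * Q)\<^sup>2 = (C\<^sub>d * Q - Ct\<^sub>d * P)\<^sup>2"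
      by (simp add: power2_eq_square algebra_simps)
    then have "(C\<^sub>d * P + Ct\<^sub>d * Q)\<^sup>2 \<le> (C\<^sub>d\<^sup>2 + Ct\<^sub>d\<^sup>2) * (P\<^sup>2 + Q\<^sup>2)"
      by (metis diff_ge_0_iff_ge zero_le_power2)
    then show ?thesis by (simp add: power_mult_distrib mult_right_mono)
  qed
  also have "\<dots> \<le> ((C\<^sub>d\<^sup>2 + Ct\<^sub>d\<^sup>2) * (P\<^sup>2 + Q\<^sup>2)) * (s / c\<^sub>a)"
    using sV c by (intro mult_left_mono) (auto simp: field_simps)
  finally have "s * s \<le> s * ((C\<^sub>d\<^sup>2 + Ct\<^sub>d\<^sup>2) / c\<^sub>a * (P\<^sup>2 + Q\<^sup>2))"
    by (simp add: power2_eq_square mult_ac)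
  then have "s \<le> (C\<^sub>d\<^sup>2 + Ct\<^sub>d\<^sup>2) / c\<^sub>a * (P\<^sup>2 + Q\<^sup>2)"
  proof (cases "s = 0")
    case False
    then show ?thesis
      using s0 \<open>s * s \<le> s * _\<close> by (metis mult_le_cancel_left_pos less_eq_real_def)
  qed (use c in simp)
  then show ?thesis by (simp add: s_def P_def Q_def)
qed

section \<open>Specialization to the matrices of linear thermo-poroelasticity\<close>

theorem theorem4p6:
  fixes A N\<^sub>V :: "real^'u^'u"
    and B Bt C Ch Ct N\<^sub>Q N\<^sub>H :: "real^'p^'p"
    and D Dt :: "real^'u^'p"
    and c\<^sub>a c\<^sub>b ct\<^sub>b c\<^sub>0 ch\<^sub>0 ct\<^sub>0 C\<^sub>d Ct\<^sub>d \<omega> T L :: real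
    and f u :: "real \<Rightarrow> real^'u"
    and g h p \<theta> :: "real \<Rightarrow> real^'p"
    and p\<^sub>0 \<theta>\<^sub>0 :: "real^'p"
  assumes "sym_pos_def N\<^sub>V" and "sym_pos_def N\<^sub>Q" and "sym_pos_def N\<^sub>H"
    and "transpose A = A" and "elliptic N\<^sub>V A c\<^sub>a"
    and "transpose B = B" and "elliptic N\<^sub>Q B c\<^sub>b"
    and "transpose Bt = Bt" and "elliptic N\<^sub>Q Bt ct\<^sub>b"
    and "C = c\<^sub>0 *\<^sub>R N\<^sub>H" and "Ch = ch\<^sub>0 *\<^sub>R N\<^sub>H" and "Ct = ct\<^sub>0 *\<^sub>R N\<^sub>H"
    and "0 < c\<^sub>0" and "0 < ch\<^sub>0" and "0 < ct\<^sub>0" and "ch\<^sub>0 < ct\<^sub>0" and "ch\<^sub>0 < c\<^sub>0"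
    and "continuous_to_dual N\<^sub>V N\<^sub>H D C\<^sub>d" and "continuous_to_dual N\<^sub>V N\<^sub>H Dt Ct\<^sub>d"
    and "0 < T"
    and "thermo_poro_solution A B Bt C Ch Ct D Dt f g h T u p \<theta>"
    and "p 0 = p\<^sub>0" and "\<theta> 0 = \<theta>\<^sub>0"
    and "Ck_on 2 {0..T} u" and "Ck_on 2 {0..T} p" and "Ck_on 2 {0..T} \<theta>"
    and "Ck_on 2 {0..T} f" and "Ck_on 1 {0..T} g" and "Ck_on 1 {0..T} h"
    and "\<omega> = omega_HD c\<^sub>a c\<^sub>0 ch\<^sub>0 ct\<^sub>0 C\<^sub>d Ct\<^sub>d"
  shows "\<exists>Cst>0. \<forall>\<tau> K u\<^sub>n p\<^sub>n \<theta>\<^sub>n.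
      0 < \<tau> \<and> 1 \<le> K \<and> \<omega> ^ K / (2 + \<omega>) ^ (K - 1) < 1
      \<and> norm (B *v p\<^sub>0 - (g 0 - D *v (matrix_inv A *v vector_derivative f (at 0 within {0..T})))) \<le> L * \<tau>
      \<and> norm (Bt *v \<theta>\<^sub>0 - (h 0 - Dt *v (matrix_inv A *v vector_derivative f (at 0 within {0..T})))) \<le> L * \<tau>
      \<and> iterative_scheme A B Bt C Ch Ct D Dt f g h T p\<^sub>0 \<theta>\<^sub>0 \<omega> \<tau> K u\<^sub>n p\<^sub>n \<theta>\<^sub>n
      \<longrightarrow> (\<forall>n. real n * \<tau> \<le> T \<longrightarrow>
            (wnorm A (u\<^sub>n n - u (real n * \<tau>)))\<^sup>2 + (wnorm B (p\<^sub>n n - p (real n * \<tau>)))\<^sup>2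
              + (wnorm Bt (\<theta>\<^sub>n n - \<theta> (real n * \<tau>)))\<^sup>2 \<le> Cst * \<tau>\<^sup>2)"
proof -
  \<comment> \<open>Pairs carry the product inner product, for which \<open>BDt\<close> is the
    adjoint of \<open>BD\<close>.\<close>
  define BD where "BD v = (D *v v, Dt *v v)" for v
  define BDt where "BDt x = transpose D *v fst x + transpose Dt *v snd x" for x
  define Cc where "Cc x = (C *v fst x - Ch *v snd x, Ct *v snd x - Ch *v fst x)" for x
  define Bb where "Bb x = (B *v fst x, Bt *v snd x)" for x
  define G where "G t = (g t, h t)" for t
  define X where "X t = (p t, \<theta> t)" for t
  note op_defs = BD_def BDt_def Cc_def Bb_def

  have A_pos: "0 < v \<bullet> (A *v v)" if "v \<noteq> 0" for v
    using elliptic_positive[OF assms(1,5) that] .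
  obtain Ai where "A ** Ai = mat 1" "Ai ** A = mat 1"
    using positive_form_imp_invertible[OF A_pos] unfolding invertible_def by blast
  then have A_inv: "A *v (Ai *v v) = v" "Ai *v (A *v v) = v" for v
    by (simp_all add: matrix_vector_mul_assoc)
  have nonneg: "0 \<le> v \<bullet> (A *v v)" "0 \<le> a \<bullet> (B *v a)" "0 \<le> a \<bullet> (Bt *v a)" for v a
    using A_pos[of v] elliptic_positive[OF assms(2,7), of a] elliptic_positive[OF assms(2,9), of a]
    by (cases "v = 0"; cases "a = 0"; simp)+

  define m where "m = min (c\<^sub>0 - ch\<^sub>0) (ct\<^sub>0 - ch\<^sub>0)"
  have m: "0 < m" using assms(16,17) by (simp add: m_def)
  have c\<^sub>a: "0 < c\<^sub>a" using assms(5) by (simp add: elliptic_def)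
  have \<omega>_eq: "\<omega> = (C\<^sub>d\<^sup>2 + Ct\<^sub>d\<^sup>2) / (c\<^sub>a * m)"
    using assms(30) by (simp add: omega_HD_def m_def)
  have \<omega>: "0 \<le> \<omega>" unfolding \<omega>_eq using m c\<^sub>a by simp
  have Cc_lower: "m * ((wnorm N\<^sub>H (fst x))\<^sup>2 + (wnorm N\<^sub>H (snd x))\<^sup>2) \<le> x \<bullet> Cc x" for x
    using mass_form_lower_bound[OF assms(3) assms(14)]
    unfolding Cc_def m_def assms(10-12) by (simp add: inner_prod_def)
  have Cc_pos: "0 < x \<bullet> Cc x" if "x \<noteq> 0" for x
  proof -
    have "0 < wnorm N\<^sub>H a" if "a \<noteq> 0" for a
      using assms(3) that by (simp add: sym_pos_def_def wnorm_def)
    note wnorm_pos = this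
    have "fst x \<noteq> 0 \<or> snd x \<noteq> 0"
      using \<open>x \<noteq> 0\<close> by (simp add: prod_eq_iff)
    then have "0 < (wnorm N\<^sub>H (fst x))\<^sup>2 + (wnorm N\<^sub>H (snd x))\<^sup>2"
      using wnorm_pos[of "fst x"] wnorm_pos[of "snd x"] by (auto simp: sum_power2_gt_zero_iff)
    then show ?thesis
      using m Cc_lower[of x] by (meson mult_pos_pos less_le_trans)
  qed
  have S_bound: "x \<bullet> BD (Ai *v BDt x) \<le> \<omega> * (x \<bullet> Cc x)" for x
  proof -
    have "x \<bullet> BD (Ai *v BDt x)
        \<le> (C\<^sub>d\<^sup>2 + Ct\<^sub>d\<^sup>2) / c\<^sub>a * ((wnorm N\<^sub>H (fst x))\<^sup>2 + (wnorm N\<^sub>H (snd x))\<^sup>2)"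
      using coupling_form_bound[OF assms(1,5,18,19), of "Ai *v BDt x" "fst x" "snd x"] A_inv(1)
      by (simp add: BD_def BDt_def inner_prod_def)
    \<comment> \<open>\<open>\<omega>\<close> is exactly the quotient of the constants in the upper
      bound for the coupling and the lower bound for the mass form.\<close>
    also have "\<dots> = \<omega> * (m * ((wnorm N\<^sub>H (fst x))\<^sup>2 + (wnorm N\<^sub>H (snd x))\<^sup>2))"
      using m c\<^sub>a by (simp add: \<omega>_eq)
    also have "\<dots> \<le> \<omega> * (x \<bullet> Cc x)"
      by (rule mult_left_mono[OF Cc_lower \<omega>])
    finally show ?thesis .
  qed
  have lin: "linear BD" "linear BDt" "linear Cc" "linear Bb"
    by (auto intro!: linearI simp: op_defs matrix_vector_right_distrib matrix_vector_mult_scaleR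
        algebra_simps scaleR_add_right scaleR_diff_right)

  note C1 = assms(24-26)[THEN C2_imp_C1]
  note deriv = C1[THEN C1_has_vector_derivative, OF assms(20)]
  have eq1: "A *v u t = BDt (X t) + f t" if "t \<in> {0..T}" for t
    using assms(21) that unfolding thermo_poro_solution_def Let_def
    by (auto simp: BDt_def X_def algebra_simps)
  \<comment> \<open>The evolution equations give the derivative of displacement part and mass part
    together; its Lipschitz bound takes the place of a bound on second derivatives.\<close>
  have eq2: "((\<lambda>t. BD (u t) + Cc (X t)) has_vector_derivative G t - Bb (X t)) (at t within {0..T})"
    if t: "t \<in> {0..T}" for t
  proof -
    have mv: "((\<lambda>t. M *v F t) has_vector_derivative M *v F') (at t within {0..T})"
      if "(F has_vector_derivative F') (at t within {0..T})" for M :: "real^'n^'m" and F F'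
      using bounded_linear.has_vector_derivative[OF matrix_vector_mul_bounded_linear that] .
    have "((\<lambda>t. BD (u t) + Cc (X t)) has_vector_derivative
       BD (vector_derivative u (at t within {0..T})) + Cc (vector_derivative p (at t within {0..T}),
         vector_derivative \<theta> (at t within {0..T}))) (at t within {0..T})"
      unfolding op_defs X_def fst_conv snd_conv
      by (intro has_vector_derivative_add has_vector_derivative_diff has_vector_derivative_Pair mv deriv t)
    also have "BD (vector_derivative u (at t within {0..T})) + Cc (vector_derivative p (at t within {0..T}),
         vector_derivative \<theta> (at t within {0..T})) = G t - Bb (X t)"
      using assms(21) t unfolding thermo_poro_solution_def Let_def
      by (auto simp: op_defs X_def G_def algebra_simps)
    finally show ?thesis .
  qed
  obtain l\<^sub>p where lp: "0 \<le> l\<^sub>p" "\<And>s t. \<lbrakk>s \<in> {0..T}; t \<in> {0..T}\<rbrakk> \<Longrightarrow> norm (p t - p s) \<le> l\<^sub>p * \<bar>t - s\<bar>"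
    using C1_closed_interval_lipschitz[OF C1(2)] by metis
  obtain l\<^sub>t where lt: "0 \<le> l\<^sub>t" "\<And>s t. \<lbrakk>s \<in> {0..T}; t \<in> {0..T}\<rbrakk> \<Longrightarrow> norm (\<theta> t - \<theta> s) \<le> l\<^sub>t * \<bar>t - s\<bar>"
    using C1_closed_interval_lipschitz[OF C1(3)] by metis
  obtain l\<^sub>g where lg: "0 \<le> l\<^sub>g" "\<And>s t. \<lbrakk>s \<in> {0..T}; t \<in> {0..T}\<rbrakk> \<Longrightarrow> norm (g t - g s) \<le> l\<^sub>g * \<bar>t - s\<bar>"
    using C1_closed_interval_lipschitz[OF assms(28)] by metis
  obtain l\<^sub>h where lh: "0 \<le> l\<^sub>h" "\<And>s t. \<lbrakk>s \<in> {0..T}; t \<in> {0..T}\<rbrakk> \<Longrightarrow> norm (h t - h s) \<le> l\<^sub>h * \<bar>t - s\<bar>"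
    using C1_closed_interval_lipschitz[OF assms(29)] by metis
  obtain b where b: "0 < b" "\<And>x. norm (Bb x) \<le> b * norm x"
    using linear_bounded_pos[OF lin(4)] by metis
  \<comment> \<open>\<open>\<Lambda>\<close> dominates the Lipschitz constants of \<open>X\<close>
    and of \<open>G - Bb X\<close> at once.\<close>
  define \<Lambda> where "\<Lambda> = (l\<^sub>p + l\<^sub>t) + ((l\<^sub>g + l\<^sub>h) + b * (l\<^sub>p + l\<^sub>t))"
  have \<Lambda>: "0 \<le> \<Lambda>" using lp(1) lt(1) lg(1) lh(1) b(1) by (simp add: \<Lambda>_def)
  have pair_diff: "norm ((a, b) - (c, d)) \<le> norm (a - c) + norm (b - d)" for a b c d :: "real^'p"
    by (simp add: norm_Pair sqrt_sum_squares_le_sum_abs[of "norm (a - c)" "norm (b - d)", simplified])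
  have lipX': "norm (X t - X s) \<le> (l\<^sub>p + l\<^sub>t) * \<bar>t - s\<bar>" if "s \<in> {0..T}" "t \<in> {0..T}" for s t
    using pair_diff[of "p t" "\<theta> t" "p s" "\<theta> s"] lp(2)[OF that] lt(2)[OF that]
    by (simp add: X_def distrib_right)
  have lipX: "norm (X t - X s) \<le> \<Lambda> * \<bar>t - s\<bar>" if "s \<in> {0..T}" "t \<in> {0..T}" for s t
  proof -
    have "(l\<^sub>p + l\<^sub>t) * \<bar>t - s\<bar> \<le> \<Lambda> * \<bar>t - s\<bar>"
      using lp(1) lt(1) lg(1) lh(1) b(1) by (intro mult_right_mono) (auto simp: \<Lambda>_def)
    with lipX'[OF that] show ?thesis by simp
  qed
  have lipG: "norm ((G t - Bb (X t)) - (G s - Bb (X s))) \<le> \<Lambda> * \<bar>t - s\<bar>"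
    if "s \<in> {0..T}" "t \<in> {0..T}" for s t
  proof -
    have "(G t - Bb (X t)) - (G s - Bb (X s)) = (G t - G s) - Bb (X t - X s)"
      by (simp add: linear_diff[OF lin(4)])
    then have "norm ((G t - Bb (X t)) - (G s - Bb (X s))) \<le> norm (G t - G s) + norm (Bb (X t - X s))"
      by (metis norm_triangle_ineq4)
    also have "\<dots> \<le> (l\<^sub>g + l\<^sub>h) * \<bar>t - s\<bar> + b * ((l\<^sub>p + l\<^sub>t) * \<bar>t - s\<bar>)"
    proof (intro add_mono)
      show "norm (G t - G s) \<le> (l\<^sub>g + l\<^sub>h) * \<bar>t - s\<bar>"
        using pair_diff[of "g t" "h t" "g s" "h s"] lg(2)[OF that] lh(2)[OF that]
        by (simp add: G_def distrib_right)
      show "norm (Bb (X t - X s)) \<le> b * ((l\<^sub>p + l\<^sub>t) * \<bar>t - s\<bar>)"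
        using order_trans[OF b(2) mult_left_mono[OF lipX'[OF that]]] b(1) by simp
    qed
    also have "\<dots> = (l\<^sub>g + l\<^sub>h + b * (l\<^sub>p + l\<^sub>t)) * \<bar>t - s\<bar>"
      by (simp add: algebra_simps)
    also have "\<dots> \<le> \<Lambda> * \<bar>t - s\<bar>"
      using lp(1) lt(1) by (intro mult_right_mono) (auto simp: \<Lambda>_def)
    finally show ?thesis .
  qed

  have adj: "x \<bullet> BD v = BDt x \<bullet> v" for x v
    by (simp add: BD_def BDt_def inner_prod_def inner_matrix_transpose[of _ D]
        inner_matrix_transpose[of _ Dt] inner_simps)
  have N_sym: "transpose N\<^sub>H = N\<^sub>H" using assms(3) by (simp add: sym_pos_def_def)
  have sym: "v \<bullet> (A *v v') = (A *v v) \<bullet> v'" "x \<bullet> Cc y = Cc x \<bullet> y" "x \<bullet> Bb y = Bb x \<bullet> y" for v v' x y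
  proof -
    show "v \<bullet> (A *v v') = (A *v v) \<bullet> v'"
      by (simp add: inner_matrix_transpose[of _ A] assms(4))
    have N: "a \<bullet> (N\<^sub>H *v b) = (N\<^sub>H *v a) \<bullet> b" for a b
      by (simp add: inner_matrix_transpose[of _ N\<^sub>H] N_sym)
    show "x \<bullet> Cc y = Cc x \<bullet> y"
      by (simp add: Cc_def inner_prod_def assms(10-12) scaleR_matrix_vector_assoc[symmetric] inner_simps N)
    show "x \<bullet> Bb y = Bb x \<bullet> y"
      by (simp add: Bb_def inner_prod_def inner_matrix_transpose[of _ B] inner_matrix_transpose[of _ Bt] assms(6,8))
  qed
  have Bb_nonneg: "0 \<le> x \<bullet> Bb x" for x
    by (simp add: Bb_def inner_prod_def nonneg)
  obtain Cst where Cst: "0 \<le> Cst" and conv: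
    "\<And>\<tau> K N U x uk xk xh. \<lbrakk>0 < \<tau>; 1 \<le> K; \<omega> ^ K / (2 + \<omega>) ^ (K - 1) < 1; real N * \<tau> \<le> T; x 0 = X 0;
      decoupled_scheme ((*v) A) BD BDt Cc Bb f G (2 / (2 + \<omega>)) \<tau> K N U x uk xk xh\<rbrakk>
      \<Longrightarrow> norm (x N - X (real N * \<tau>)) \<le> Cst * \<tau> \<and> norm (U N - u (real N * \<tau>)) \<le> Cst * \<tau>"
    using decoupled_scheme_first_order[OF matrix_vector_mul_linear matrix_vector_mul_linear lin
        A_inv adj sym nonneg(1) Cc_pos Bb_nonneg \<omega> S_bound assms(20) \<Lambda> eq1 eq2 lipX lipG]
    by metis
  obtain k\<^sub>A where kA: "0 \<le> k\<^sub>A" "\<And>x. (wnorm A x)\<^sup>2 \<le> k\<^sub>A * (norm x)\<^sup>2"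
    using wnorm_square_bound[of A] by metis
  obtain k\<^sub>B where kB: "0 \<le> k\<^sub>B" "\<And>x. (wnorm B x)\<^sup>2 \<le> k\<^sub>B * (norm x)\<^sup>2"
    using wnorm_square_bound[of B] by metis
  obtain k\<^sub>t where kt: "0 \<le> k\<^sub>t" "\<And>x. (wnorm Bt x)\<^sup>2 \<le> k\<^sub>t * (norm x)\<^sup>2"
    using wnorm_square_bound[of Bt] by metis
  have sq: "k * (norm y)\<^sup>2 \<le> k * Cst\<^sup>2 * \<tau>\<^sup>2" if "0 \<le> k" "norm y \<le> Cst * \<tau>" for k \<tau> and y :: "'z::real_normed_vector"
    using that power_mono[OF that(2), of 2] by (simp add: power_mult_distrib mult.assoc mult_left_mono)
  show ?thesis
  \<comment> \<open>The added 1 makes the constant positive even if all the other factors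
    vanish.\<close>
  proof (intro exI[of _ "(k\<^sub>A + k\<^sub>B + k\<^sub>t) * Cst\<^sup>2 + 1"] conjI allI impI; (elim conjE)?)
    show "0 < (k\<^sub>A + k\<^sub>B + k\<^sub>t) * Cst\<^sup>2 + 1"
      using kA(1) kB(1) kt(1) by (simp add: add_nonneg_pos)
    fix \<tau> :: real and K :: nat and u\<^sub>n :: "nat \<Rightarrow> real^'u" and p\<^sub>n \<theta>\<^sub>n :: "nat \<Rightarrow> real^'p" and n :: nat
    assume \<tau>: "0 < \<tau>" and K: "1 \<le> K" "\<omega> ^ K / (2 + \<omega>) ^ (K - 1) < 1" and n: "real n * \<tau> \<le> T"
      and scheme: "iterative_scheme A B Bt C Ch Ct D Dt f g h T p\<^sub>0 \<theta>\<^sub>0 \<omega> \<tau> K u\<^sub>n p\<^sub>n \<theta>\<^sub>n"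
    from scheme obtain uk pk \<theta>k ph \<theta>h where init: "p\<^sub>n 0 = p\<^sub>0" "\<theta>\<^sub>n 0 = \<theta>\<^sub>0"
        "A *v u\<^sub>n 0 = transpose D *v p\<^sub>0 + transpose Dt *v \<theta>\<^sub>0 + f 0"
      and step: "\<And>n. real (Suc n) * \<tau> \<le> T \<Longrightarrow>
          uk n 0 = u\<^sub>n n \<and> pk n 0 = p\<^sub>n n \<and> \<theta>k n 0 = \<theta>\<^sub>n n \<and>
          (\<forall>k<K.
             A *v uk n (Suc k) = transpose D *v pk n k + transpose Dt *v \<theta>k n k + f (real (Suc n) * \<tau>) \<and>
             D *v uk n (Suc k) + (C + \<tau> *\<^sub>R B) *v ph n (Suc k) - Ch *v \<theta>h n (Suc k)
               = D *v u\<^sub>n n + C *v p\<^sub>n n - Ch *v \<theta>\<^sub>n n + \<tau> *\<^sub>R g (real (Suc n) * \<tau>) \<and>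
             Dt *v uk n (Suc k) - Ch *v ph n (Suc k) + (Ct + \<tau> *\<^sub>R Bt) *v \<theta>h n (Suc k)
               = Dt *v u\<^sub>n n - Ch *v p\<^sub>n n + Ct *v \<theta>\<^sub>n n + \<tau> *\<^sub>R h (real (Suc n) * \<tau>)) \<and>
          (\<forall>k. Suc k < K \<longrightarrow>
             pk n (Suc k) = (2 / (2 + \<omega>)) *\<^sub>R ph n (Suc k) + (1 - 2 / (2 + \<omega>)) *\<^sub>R pk n k \<and>
             \<theta>k n (Suc k) = (2 / (2 + \<omega>)) *\<^sub>R \<theta>h n (Suc k) + (1 - 2 / (2 + \<omega>)) *\<^sub>R \<theta>k n k) \<and>
          u\<^sub>n (Suc n) = uk n K \<and> p\<^sub>n (Suc n) = ph n K \<and> \<theta>\<^sub>n (Suc n) = \<theta>h n K"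
      unfolding iterative_scheme_def Let_def by blast
    define x where "x j = (p\<^sub>n j, \<theta>\<^sub>n j)" for j
    define xk where "xk j k = (pk j k, \<theta>k j k)" for j k
    define xh where "xh j k = (ph j k, \<theta>h j k)" for j k
    \<comment> \<open>The abstract bound concerns the last step of a run, so the block scheme is run
      exactly up to the given \<open>n\<close>.\<close>
    have "decoupled_scheme ((*v) A) BD BDt Cc Bb f G (2 / (2 + \<omega>)) \<tau> K n u\<^sub>n x uk xk xh"
      unfolding decoupled_scheme_def
    proof (intro conjI allI impI)
      show "A *v u\<^sub>n 0 = BDt (x 0) + f 0"
        by (simp add: x_def init BDt_def)
      fix j assume j: "j < n"
      have "real (Suc j) * \<tau> \<le> real n * \<tau>" using j \<tau> by (intro mult_right_mono) auto
      then have "real (Suc j) * \<tau> \<le> T" using n by (rule order_trans)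
      note st = step[OF this]
      show "xk j 0 = x j" using st by (simp add: xk_def x_def)
      show "u\<^sub>n (Suc j) = uk j K" "x (Suc j) = xh j K" using st by (simp_all add: x_def xh_def)
      show "xk j (Suc k) = (2 / (2 + \<omega>)) *\<^sub>R xh j (Suc k) + (1 - 2 / (2 + \<omega>)) *\<^sub>R xk j k" if "Suc k < K" for k
        using st that by (simp add: xk_def xh_def)
      fix k assume k: "k < K"
      show "A *v uk j (Suc k) = BDt (xk j k) + f (real (Suc j) * \<tau>)"
        using st k by (simp add: xk_def BDt_def)
      from st k have
        "D *v uk j (Suc k) + (C + \<tau> *\<^sub>R B) *v ph j (Suc k) - Ch *v \<theta>h j (Suc k)
           = D *v u\<^sub>n j + C *v p\<^sub>n j - Ch *v \<theta>\<^sub>n j + \<tau> *\<^sub>R g (real (Suc j) * \<tau>)"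
        "Dt *v uk j (Suc k) - Ch *v ph j (Suc k) + (Ct + \<tau> *\<^sub>R Bt) *v \<theta>h j (Suc k)
           = Dt *v u\<^sub>n j - Ch *v p\<^sub>n j + Ct *v \<theta>\<^sub>n j + \<tau> *\<^sub>R h (real (Suc j) * \<tau>)"
        by blast+
      then show "BD (uk j (Suc k)) + (Cc (xh j (Suc k)) + \<tau> *\<^sub>R Bb (xh j (Suc k)))
          = BD (u\<^sub>n j) + Cc (x j) + \<tau> *\<^sub>R G (real (Suc j) * \<tau>)"
        by (simp add: op_defs x_def xh_def G_def matrix_vector_mult_add_rdistrib
            scaleR_matrix_vector_assoc[symmetric] algebra_simps)
    qed
    moreover have "x 0 = X 0" by (simp add: x_def X_def init assms(22,23))
    ultimately have bx: "norm (x n - X (real n * \<tau>)) \<le> Cst * \<tau>"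
      and bu: "norm (u\<^sub>n n - u (real n * \<tau>)) \<le> Cst * \<tau>"
      using conv[OF \<tau> K n] by auto
    have bp: "norm (p\<^sub>n n - p (real n * \<tau>)) \<le> Cst * \<tau>" and bt: "norm (\<theta>\<^sub>n n - \<theta> (real n * \<tau>)) \<le> Cst * \<tau>"
      using order_trans[OF norm_fst_le bx[unfolded x_def X_def diff_Pair]]
        order_trans[OF norm_snd_le bx[unfolded x_def X_def diff_Pair]] by simp_all
    have "(wnorm A (u\<^sub>n n - u (real n * \<tau>)))\<^sup>2 + (wnorm B (p\<^sub>n n - p (real n * \<tau>)))\<^sup>2
        + (wnorm Bt (\<theta>\<^sub>n n - \<theta> (real n * \<tau>)))\<^sup>2
      \<le> k\<^sub>A * Cst\<^sup>2 * \<tau>\<^sup>2 + k\<^sub>B * Cst\<^sup>2 * \<tau>\<^sup>2 + k\<^sub>t * Cst\<^sup>2 * \<tau>\<^sup>2"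
      by (intro add_mono order_trans[OF kA(2) sq[OF kA(1) bu]] order_trans[OF kB(2) sq[OF kB(1) bp]]
          order_trans[OF kt(2) sq[OF kt(1) bt]])
    also have "\<dots> \<le> ((k\<^sub>A + k\<^sub>B + k\<^sub>t) * Cst\<^sup>2 + 1) * \<tau>\<^sup>2"
      by (simp add: algebra_simps)
    finally show "(wnorm A (u\<^sub>n n - u (real n * \<tau>)))\<^sup>2 + (wnorm B (p\<^sub>n n - p (real n * \<tau>)))\<^sup>2
        + (wnorm Bt (\<theta>\<^sub>n n - \<theta> (real n * \<tau>)))\<^sup>2 \<le> ((k\<^sub>A + k\<^sub>B + k\<^sub>t) * Cst\<^sup>2 + 1) * \<tau>\<^sup>2" .
  qed
qed

end
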